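(* Let $1<p<\infty$ and let $I$ be an uncountable index set. Then $L^{p,\infty}(\{-1,1\}^I)$ is not isomorphic to a subspace of $L^{p,\infty}(\Omega,\Sigma,\mu)$ for any purely atomic measure space $(\Omega,\Sigma,\mu)$.
   Context: $\{-1,1\}$ denotes the two-point probability space with each point of mass $\frac12$, and $\{-1,1\}^I$ the product probability space of $I$ copies of it. For a measure space $(\Omega,\Sigma,\mu)$, $L^{p,\infty}(\Omega,\Sigma,\mu)$ is the space of (equivalence classes of) measurable $f$ with $\|f\|=\sup_{c>0}c\,(\mu\{|f|>c\})^{1/p}<\infty$, a Banach space under an equivalent norm; isomorphism means linear homeomorphism. An atom is a measurable set $\sigma$ with $\mu(\sigma)>0$ such that each measurable $\sigma'\subseteq\sigma$ has $\mu(\sigma')=0$ or $\mu(\sigma\setminus\sigma')=0$. The space is purely atomic if $\Sigma$ is the smallest $\sigma$-algebra containing all atoms and all $\mu$-null sets. Measure spaces are assumed to contain a set of finite non-zero measure. *)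

theory Defs
  imports "HOL-Probability.Probability"
begin

definition two_point :: "real measure" where
  "two_point = uniform_count_measure {-1, 1}"

definition cantor_cube :: "'i set \<Rightarrow> ('i \<Rightarrow> real) measure" where
  "cantor_cube I = PiM I (\<lambda>_. two_point)"

definition weak_norm :: "'a measure \<Rightarrow> real \<Rightarrow> ('a \<Rightarrow> real) \<Rightarrow> ennreal" where
  "weak_norm M p f =
     (SUP c\<in>{0<..}. (let m = emeasure M {x \<in> space M. c < \<bar>f x\<bar>} in
        if m = \<infinity> then \<infinity> else ennreal (c * (enn2real m) powr (1 / p))))"

definition Lp_weak :: "'a measure \<Rightarrow> real \<Rightarrow> ('a \<Rightarrow> real) set" where
  "Lp_weak M p = {f \<in> borel_measurable M. weak_norm M p f < \<infinity>}"

text \<open>L^{p,infinity}(M) is isomorphic to a subspace of L^{p,infinity}(N): there is a map on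
  representatives which is linear modulo null sets and bounded above and below w.r.t. the
  (equivalent) quasi-norm; equivalently a linear homeomorphism onto its image.\<close>
definition weak_Lp_embeds :: "'a measure \<Rightarrow> 'b measure \<Rightarrow> real \<Rightarrow> bool" where
  "weak_Lp_embeds M N p \<longleftrightarrow>
     (\<exists>T :: ('a \<Rightarrow> real) \<Rightarrow> ('b \<Rightarrow> real). \<exists>c C :: real. 0 < c \<and>
        (\<forall>f \<in> Lp_weak M p. T f \<in> Lp_weak N p \<and>
            ennreal c * weak_norm M p f \<le> weak_norm N p (T f) \<and>
            weak_norm N p (T f) \<le> ennreal C * weak_norm M p f) \<and>
        (\<forall>f \<in> Lp_weak M p. \<forall>g \<in> Lp_weak M p. \<forall>a b :: real.
            AE y in N. T (\<lambda>x. a * f x + b * g x) y = a * T f y + b * T g y))"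

definition is_atom :: "'a measure \<Rightarrow> 'a set \<Rightarrow> bool" where
  "is_atom M A \<longleftrightarrow> A \<in> sets M \<and> 0 < emeasure M A \<and>
     (\<forall>B \<in> sets M. B \<subseteq> A \<longrightarrow> emeasure M B = 0 \<or> emeasure M (A - B) = 0)"

definition purely_atomic :: "'a measure \<Rightarrow> bool" where
  "purely_atomic M \<longleftrightarrow>
     sets M = sigma_sets (space M) ({A. is_atom M A} \<union> null_sets M)"

end

theory Submission
  imports Defs
begin

text \<open>Let T be an embedding, let x i (i \<in> I) be the coordinates and let g be bounded. On each atom of
  finite measure, T (g * x i) vanishes for all but countably many i: otherwise infinitely many of them
  would be bounded below with a common sign, and their sums would grow linearly in the number of terms,
  although sums of n coordinates have norm o(n). As sets of finite measure are covered by countably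
  many atoms, one can choose, for any given g k, distinct indices s k such that the functions
  T (g k * x (s k)) are disjoint.

  A sum of n disjoint functions of bounded weak norm has norm at most of order n powr (1 / p), and,
  if they all have a fixed share above a common level, at least of this order. If p < 2, take g k = 1:
  by uncountability there are infinitely many T (x i) with a common level, but a sum of n coordinates
  has norm at most sqrt n. If p \<ge> 2, choose g k of weak norm 1 such that the sum of g k * x (s k) over
  k < N has size N powr (1 / p) * sqrt (harm N) on a set of measure at least 1/6; this beats
  N powr (1 / p).\<close>

section \<open>Moments on the Cantor cube\<close>

text \<open>The exponent 2 is what forces the multipliers \<open>g k\<close>. With constant
  multipliers one compares sqrt n, the typical size of a sum of n coordinates, with n powr (1 / p),
  the order of a sum of n disjoint images, and for p = 2 these agree. The gain comes from the
  function u powr (- 1 / 2) on the unit interval: its weak L2 norm is finite, its L2 norm is not.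
  Discretized on N steps, this divergence becomes the factor \<open>harm N\<close>. The functions
  \<open>g k\<close> are rearrangements of one such profile, arranged so that the sum of their
  squares is the same at every point. The signed sum then has constant conditional variance, so its
  fourth moment is controlled by the square of its second moment, and its size is attained with
  probability bounded below, not only on average; a weak norm needs exactly this. Since
  \<open>T\<close> need not respect supports in any way, disjointness of the images has to be
  produced by the choice of coordinates.\<close>

text \<open>The class of test functions: closed under sums, products and powers, so that every
  moment below is an integral of an integrable function, and contained in every weak space over a
  probability space.\<close>

definition bounded_measurable :: "'a measure \<Rightarrow> ('a \<Rightarrow> real) set" where
  "bounded_measurable M = {f \<in> borel_measurable M. \<exists>B. \<forall>x\<in>space M. \<bar>f x\<bar> \<le> B}"

lemma bounded_measurableI:
  "f \<in> borel_measurable M \<Longrightarrow> (\<And>x. x \<in> space M \<Longrightarrow> \<bar>f x\<bar> \<le> B) \<Longrightarrow> f \<in> bounded_measurable M"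
  unfolding bounded_measurable_def by blast

lemma bounded_measurable_measurable: "f \<in> bounded_measurable M \<Longrightarrow> f \<in> borel_measurable M"
  unfolding bounded_measurable_def by blast

lemma bounded_measurable_const: "(\<lambda>x. c) \<in> bounded_measurable M"
  by (rule bounded_measurableI[of _ _ "\<bar>c\<bar>"]) auto

lemma bounded_measurable_add:
  assumes "f \<in> bounded_measurable M" "g \<in> bounded_measurable M"
  shows "(\<lambda>x. f x + g x) \<in> bounded_measurable M"
proof -
  obtain A B where "\<And>x. x \<in> space M \<Longrightarrow> \<bar>f x\<bar> \<le> A" "\<And>x. x \<in> space M \<Longrightarrow> \<bar>g x\<bar> \<le> B"
    using assms unfolding bounded_measurable_def by blast
  then have "\<And>x. x \<in> space M \<Longrightarrow> \<bar>f x + g x\<bar> \<le> A + B"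
    by (meson abs_triangle_ineq add_mono order_trans)
  then show ?thesis
    using assms[THEN bounded_measurable_measurable] by (intro bounded_measurableI[where B = "A + B"]) auto
qed

lemma bounded_measurable_mult:
  assumes "f \<in> bounded_measurable M" "g \<in> bounded_measurable M"
  shows "(\<lambda>x. f x * g x) \<in> bounded_measurable M"
proof -
  obtain A B where "\<And>x. x \<in> space M \<Longrightarrow> \<bar>f x\<bar> \<le> A" "\<And>x. x \<in> space M \<Longrightarrow> \<bar>g x\<bar> \<le> B"
    using assms unfolding bounded_measurable_def by blast
  then have "\<And>x. x \<in> space M \<Longrightarrow> \<bar>f x * g x\<bar> \<le> A * B"
    unfolding abs_mult by (meson abs_ge_zero mult_mono order_trans)
  then show ?thesis
    using assms[THEN bounded_measurable_measurable] by (intro bounded_measurableI[where B = "A * B"]) auto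
qed

lemma bounded_measurable_power:
  "f \<in> bounded_measurable M \<Longrightarrow> (\<lambda>x. f x ^ n) \<in> bounded_measurable M"
  by (induction n) (auto intro: bounded_measurable_mult bounded_measurable_const)

lemma bounded_measurable_sum:
  "(\<And>k. k \<in> K \<Longrightarrow> f k \<in> bounded_measurable M) \<Longrightarrow> (\<lambda>x. \<Sum>k\<in>K. f k x) \<in> bounded_measurable M"
  by (induction K rule: infinite_finite_induct)
    (auto intro: bounded_measurable_add bounded_measurable_const)

lemmas bounded_measurable_intros =
  bounded_measurable_const bounded_measurable_add bounded_measurable_mult
  bounded_measurable_power bounded_measurable_sum

lemma (in finite_measure) bounded_measurable_integrable:
  "f \<in> bounded_measurable M \<Longrightarrow> integrable M f"
  unfolding bounded_measurable_def by (auto intro!: integrable_const_bound AE_I2)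

section \<open>The two-point space and the coordinate flips of the cube\<close>

lemma space_two_point [simp]: "space two_point = {-1, 1}"
  and sets_two_point [simp]: "sets two_point = Pow {-1, 1}"
  unfolding two_point_def by (auto simp: space_uniform_count_measure sets_uniform_count_measure)

lemma emeasure_two_point: "A \<subseteq> {-1, 1} \<Longrightarrow> emeasure two_point A = ennreal (card A / 2)"
  unfolding two_point_def by (subst emeasure_uniform_count_measure) auto

lemma prob_space_two_point: "prob_space two_point"
  unfolding two_point_def by (rule prob_space_uniform_count_measure) auto

lemma product_prob_space_two_point: "product_prob_space (\<lambda>_. two_point)"
  using prob_space_two_point
  by (simp add: product_prob_space_def product_prob_space_axioms_def product_sigma_finite_def
      prob_space_imp_sigma_finite)

lemma prob_space_cantor_cube: "prob_space (cantor_cube I)"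
  unfolding cantor_cube_def by (rule prob_space_PiM) (rule prob_space_two_point)

lemma space_cantor_cube: "space (cantor_cube I) = (\<Pi>\<^sub>E i\<in>I. {-1, 1})"
  unfolding cantor_cube_def by (simp add: space_PiM)

lemma cantor_cube_coord: "x \<in> space (cantor_cube I) \<Longrightarrow> i \<in> I \<Longrightarrow> x i = -1 \<or> x i = 1"
  unfolding space_cantor_cube by (auto simp: PiE_iff)

lemma flip_in_cantor_cube:
  "x \<in> space (cantor_cube I) \<Longrightarrow> i \<in> I \<Longrightarrow> x(i := - x i) \<in> space (cantor_cube I)"
  unfolding space_cantor_cube by (force simp: PiE_iff extensional_def)

lemma measurable_two_point: "f \<in> borel_measurable two_point"
  unfolding measurable_def by auto

lemma measurable_coord_two_point: "i \<in> I \<Longrightarrow> (\<lambda>x. x i) \<in> measurable (cantor_cube I) two_point"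
  unfolding cantor_cube_def by (rule measurable_component_singleton)

lemma measurable_coord: "i \<in> I \<Longrightarrow> (\<lambda>x. x i) \<in> borel_measurable (cantor_cube I)"
  by (rule measurable_compose[OF measurable_coord_two_point measurable_two_point])

lemma bounded_measurable_coord: "i \<in> I \<Longrightarrow> (\<lambda>x. x i) \<in> bounded_measurable (cantor_cube I)"
  by (rule bounded_measurableI[of _ _ 1]) (auto intro: measurable_coord dest: cantor_cube_coord)

lemma measurable_flip:
  assumes "i \<in> I"
  shows "(\<lambda>x. x(i := - x i)) \<in> measurable (cantor_cube I) (cantor_cube I)"
proof -
  have 1: "uminus \<in> measurable two_point two_point"
    by (auto simp: measurable_def)
  have 2: "(\<lambda>x. - x i) \<in> measurable (cantor_cube I) two_point"
    by (rule measurable_compose[OF measurable_coord_two_point[OF assms] 1])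
  show ?thesis
    using assms 2 unfolding cantor_cube_def
    by (intro measurable_fun_upd[where J = I]) auto
qed

text \<open>A product measure is determined by its values on cylinders. The flip pulls a cylinder
  back to the one whose side at \<open>i\<close> is reflected, and reflection preserves the
  cardinality of a subset of {-1, 1}.\<close>

lemma distr_flip:
  assumes i: "i \<in> I"
  shows "distr (cantor_cube I) (cantor_cube I) (\<lambda>x. x(i := - x i)) = cantor_cube I"
proof -
  interpret product_prob_space "\<lambda>_. two_point" I
    by (rule product_prob_space_two_point)
  let ?M = "PiM I (\<lambda>_. two_point)"
  have "distr ?M ?M (\<lambda>x. x(i := - x i)) = ?M"
  proof (rule PiM_eq)
    fix J and F :: "'a \<Rightarrow> real set"
    assume J: "finite J" "J \<subseteq> I" and F: "\<And>j. j \<in> J \<Longrightarrow> F j \<in> sets two_point"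
    define G where "G = (\<lambda>j. if j = i then uminus ` F j else F j)"
    have G: "G j \<in> sets two_point" if "j \<in> J" for j
      using F[OF that] unfolding G_def by auto
    have eq: "(\<lambda>x. x(i := - x i)) -` prod_emb I (\<lambda>_. two_point) J (\<Pi>\<^sub>E j\<in>J. F j) \<inter> space ?M
        = prod_emb I (\<lambda>_. two_point) J (\<Pi>\<^sub>E j\<in>J. G j)" (is "?L = ?R")
    proof (rule set_eqI)
      fix x
      have im: "- y \<in> F i \<longleftrightarrow> y \<in> uminus ` F i" for y :: real
        by (metis imageE image_eqI minus_minus)
      have "x \<in> ?L \<longleftrightarrow> x \<in> space ?M \<and> (\<forall>j\<in>J. (x(i := - x i)) j \<in> F j)"
        using flip_in_cantor_cube[of x I i] i
        by (auto simp: prod_emb_def space_PiM cantor_cube_def PiE_iff)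
      also have "\<dots> \<longleftrightarrow> x \<in> space ?M \<and> (\<forall>j\<in>J. x j \<in> G j)"
        unfolding G_def using im by (auto split: if_splits)
      also have "\<dots> \<longleftrightarrow> x \<in> ?R"
        by (auto simp: prod_emb_def space_PiM PiE_iff)
      finally show "x \<in> ?L \<longleftrightarrow> x \<in> ?R" .
    qed
    have m: "emeasure two_point (G j) = emeasure two_point (F j)" if "j \<in> J" for j
    proof -
      have "card (G j) = card (F j)"
        unfolding G_def by (auto intro!: card_image inj_onI)
      then show ?thesis
        using F[OF that] G[OF that] by (simp add: emeasure_two_point)
    qed
    have "emeasure (distr ?M ?M (\<lambda>x. x(i := - x i))) (prod_emb I (\<lambda>_. two_point) J (\<Pi>\<^sub>E j\<in>J. F j))
        = emeasure ?M (prod_emb I (\<lambda>_. two_point) J (\<Pi>\<^sub>E j\<in>J. G j))"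
      using measurable_flip[OF i] J F
      by (subst emeasure_distr) (auto simp: cantor_cube_def eq[simplified] intro!: sets_PiM_I)
    also have "\<dots> = (\<Prod>j\<in>J. emeasure two_point (G j))"
      using J G by (intro emeasure_PiM_emb) auto
    finally show "emeasure (distr ?M ?M (\<lambda>x. x(i := - x i))) (prod_emb I (\<lambda>_. two_point) J (\<Pi>\<^sub>E j\<in>J. F j))
        = (\<Prod>j\<in>J. emeasure two_point (F j))"
      using m by simp
  qed simp
  then show ?thesis unfolding cantor_cube_def .
qed

text \<open>The flip preserves the measure, so the integral equals its own negative. This symmetry
  takes the place of independence: it removes the odd terms in the moment expansions.\<close>

lemma integral_odd_zero:
  fixes F :: "('i \<Rightarrow> real) \<Rightarrow> real"
  assumes "i \<in> I" "F \<in> borel_measurable (cantor_cube I)"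
    and odd: "\<And>x. x \<in> space (cantor_cube I) \<Longrightarrow> F (x(i := - x i)) = - F x"
  shows "integral\<^sup>L (cantor_cube I) F = 0"
proof -
  have "integral\<^sup>L (cantor_cube I) F = (\<integral>x. F (x(i := - x i)) \<partial>cantor_cube I)"
    by (subst distr_flip[OF assms(1), symmetric])
      (rule integral_distr[OF measurable_flip[OF assms(1)] assms(2)])
  also have "\<dots> = (\<integral>x. - F x \<partial>cantor_cube I)"
    by (rule Bochner_Integration.integral_cong) (auto simp: odd)
  finally show ?thesis by simp
qed

text \<open>When an index \<open>j\<close> is added, the cross term is odd in the coordinate
  \<open>s j\<close> and integrates to 0. The coefficients may vary with \<open>x\<close>, but not
  with the coordinates \<open>s l\<close>. The weight \<open>w\<close> serves the fourth moment,
  where the square of a new coefficient takes its place.\<close>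

lemma rademacher_second_moment:
  fixes a :: "'k \<Rightarrow> ('i \<Rightarrow> real) \<Rightarrow> real"
  defines "C \<equiv> cantor_cube"
  assumes "finite K" "inj_on s K" "s ` K \<subseteq> I"
    and "\<And>k. k \<in> K \<Longrightarrow> a k \<in> bounded_measurable (C I)"
    and "\<And>k l x. k \<in> K \<Longrightarrow> l \<in> K \<Longrightarrow> x \<in> space (C I) \<Longrightarrow> a k (x(s l := - x (s l))) = a k x"
    and "w \<in> bounded_measurable (C I)"
    and "\<And>l x. l \<in> K \<Longrightarrow> x \<in> space (C I) \<Longrightarrow> w (x(s l := - x (s l))) = w x"
  shows "(\<integral>x. (\<Sum>k\<in>K. a k x * x (s k))\<^sup>2 * w x \<partial>C I) = (\<integral>x. (\<Sum>k\<in>K. (a k x)\<^sup>2) * w x \<partial>C I)"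
  using assms(2-)
proof (induction K rule: finite_induct)
  case (insert j K)
  interpret prob_space "C I" unfolding C_def by (rule prob_space_cantor_cube)
  define S where "S = (\<lambda>x. \<Sum>k\<in>K. a k x * x (s k))"
  define V where "V = (\<lambda>x. \<Sum>k\<in>K. (a k x)\<^sup>2)"
  have S_eq: "(\<Sum>k\<in>K. a k x * x (s k)) = S x" and V_eq: "(\<Sum>k\<in>K. (a k x)\<^sup>2) = V x" for x
    unfolding S_def V_def by auto
  have j: "s j \<in> I" using insert.prems by auto
  have sk: "s k \<noteq> s j" if "k \<in> K" for k
    using insert.prems(1) insert.hyps(2) that by (auto simp: inj_on_def)
  have bm: "S \<in> bounded_measurable (C I)" "V \<in> bounded_measurable (C I)"
    "a j \<in> bounded_measurable (C I)" "(\<lambda>x. x (s j)) \<in> bounded_measurable (C I)"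
    "w \<in> bounded_measurable (C I)"
    unfolding S_def V_def using insert.prems bounded_measurable_coord[of _ I, folded C_def]
    by (auto intro!: bounded_measurable_intros)
  have sq: "x (s j) * x (s j) = 1" if "x \<in> space (C I)" for x
    using cantor_cube_coord[of x I "s j"] that j unfolding C_def by auto
  have a_flip: "a k (x(s l := - x (s l))) = a k x"
    if "k \<in> insert j K" "l \<in> insert j K" "x \<in> space (C I)" for k l x
    by (rule insert.prems(4)[OF that])
  have S_flip: "S (x(s j := - x (s j))) = S x" if "x \<in> space (C I)" for x
    unfolding S_def
  proof (intro sum.cong refl)
    fix k assume k: "k \<in> K"
    have "a k (x(s j := - x (s j))) = a k x"
      using k that by (intro a_flip) auto
    then show "a k (x(s j := - x (s j))) * (x(s j := - x (s j))) (s k) = a k x * x (s k)"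
      using sk[OF k] by simp
  qed
  have IH: "(\<integral>x. (S x)\<^sup>2 * w x \<partial>C I) = (\<integral>x. V x * w x \<partial>C I)"
    unfolding S_def V_def using insert.prems by (intro insert.IH) auto
  have odd: "(\<integral>x. S x * a j x * x (s j) * w x \<partial>C I) = 0"
    using j bm unfolding C_def
    by (intro integral_odd_zero[of "s j"])
      (auto simp: C_def[symmetric] S_flip a_flip insert.prems(6)
        intro!: bounded_measurable_measurable bounded_measurable_intros)
  have "(\<integral>x. (\<Sum>k\<in>insert j K. a k x * x (s k))\<^sup>2 * w x \<partial>C I)
      = (\<integral>x. (S x)\<^sup>2 * w x + (2 * (S x * a j x * x (s j) * w x) + (a j x)\<^sup>2 * w x) \<partial>C I)"
  proof (rule Bochner_Integration.integral_cong)
    fix x assume x: "x \<in> space (C I)"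
    have "(a j x * x (s j) + S x)\<^sup>2 = (S x)\<^sup>2 + (2 * (S x * a j x * x (s j)) + (a j x)\<^sup>2 * (x (s j) * x (s j)))"
      by (simp add: power2_eq_square algebra_simps)
    then show "(\<Sum>k\<in>insert j K. a k x * x (s k))\<^sup>2 * w x
        = (S x)\<^sup>2 * w x + (2 * (S x * a j x * x (s j) * w x) + (a j x)\<^sup>2 * w x)"
      using insert.hyps by (simp add: S_eq sq[OF x] algebra_simps)
  qed simp
  also have "\<dots> = (\<integral>x. (S x)\<^sup>2 * w x \<partial>C I) + (2 * (\<integral>x. S x * a j x * x (s j) * w x \<partial>C I)
      + (\<integral>x. (a j x)\<^sup>2 * w x \<partial>C I))"
    using bm by (simp add: bounded_measurable_integrable bounded_measurable_intros)
  also have "\<dots> = (\<integral>x. V x * w x + (a j x)\<^sup>2 * w x \<partial>C I)"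
    unfolding IH odd
    using bm by (simp add: bounded_measurable_integrable bounded_measurable_intros)
  also have "\<dots> = (\<integral>x. (\<Sum>k\<in>insert j K. (a k x)\<^sup>2) * w x \<partial>C I)"
    using insert.hyps by (simp add: V_eq algebra_simps)
  finally show ?case .
qed simp

text \<open>The terms of odd degree in the new sign vanish, and the weighted second moment turns 6
  S^2 a^2 into 6 V a^2. As 3 (V + a^2)^2 = 3 V^2 + 6 V a^2 + 3 a^4, the constant 3 is the one with
  which the induction closes.\<close>

lemma rademacher_fourth_moment:
  fixes a :: "'k \<Rightarrow> ('i \<Rightarrow> real) \<Rightarrow> real"
  defines "C \<equiv> cantor_cube"
  assumes "finite K" "inj_on s K" "s ` K \<subseteq> I"
    and "\<And>k. k \<in> K \<Longrightarrow> a k \<in> bounded_measurable (C I)"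
    and "\<And>k l x. k \<in> K \<Longrightarrow> l \<in> K \<Longrightarrow> x \<in> space (C I) \<Longrightarrow> a k (x(s l := - x (s l))) = a k x"
  shows "(\<integral>x. (\<Sum>k\<in>K. a k x * x (s k)) ^ 4 \<partial>C I) \<le> 3 * (\<integral>x. (\<Sum>k\<in>K. (a k x)\<^sup>2)\<^sup>2 \<partial>C I)"
  using assms(2-)
proof (induction K rule: finite_induct)
  case (insert j K)
  interpret prob_space "C I" unfolding C_def by (rule prob_space_cantor_cube)
  define S where "S = (\<lambda>x. \<Sum>k\<in>K. a k x * x (s k))"
  define V where "V = (\<lambda>x. \<Sum>k\<in>K. (a k x)\<^sup>2)"
  have S_eq: "(\<Sum>k\<in>K. a k x * x (s k)) = S x" and V_eq: "(\<Sum>k\<in>K. (a k x)\<^sup>2) = V x" for x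
    unfolding S_def V_def by auto
  have j: "s j \<in> I" using insert.prems by auto
  have sk: "s k \<noteq> s j" if "k \<in> K" for k
    using insert.prems(1) insert.hyps(2) that by (auto simp: inj_on_def)
  have bm: "S \<in> bounded_measurable (C I)" "V \<in> bounded_measurable (C I)"
    "a j \<in> bounded_measurable (C I)" "(\<lambda>x. x (s j)) \<in> bounded_measurable (C I)"
    unfolding S_def V_def using insert.prems bounded_measurable_coord[of _ I, folded C_def]
    by (auto intro!: bounded_measurable_intros)
  have sq: "x (s j) * x (s j) = 1" if "x \<in> space (C I)" for x
    using cantor_cube_coord[of x I "s j"] that j unfolding C_def by auto
  have a_flip: "a k (x(s l := - x (s l))) = a k x"
    if "k \<in> insert j K" "l \<in> insert j K" "x \<in> space (C I)" for k l x
    by (rule insert.prems(4)[OF that])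
  have S_flip: "S (x(s j := - x (s j))) = S x" if "x \<in> space (C I)" for x
    unfolding S_def
  proof (intro sum.cong refl)
    fix k assume k: "k \<in> K"
    have "a k (x(s j := - x (s j))) = a k x"
      using k that by (intro a_flip) auto
    then show "a k (x(s j := - x (s j))) * (x(s j := - x (s j))) (s k) = a k x * x (s k)"
      using sk[OF k] by simp
  qed
  have IH: "(\<integral>x. S x ^ 4 \<partial>C I) \<le> 3 * (\<integral>x. (V x)\<^sup>2 \<partial>C I)"
    unfolding S_def V_def using insert.prems by (intro insert.IH) auto
  have second: "(\<integral>x. (S x)\<^sup>2 * (a j x)\<^sup>2 \<partial>C I) = (\<integral>x. V x * (a j x)\<^sup>2 \<partial>C I)"
    unfolding S_def V_def C_def using insert.prems(1,2,3) insert.hyps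
    by (intro rademacher_second_moment)
      (auto simp: C_def[symmetric] a_flip intro: bounded_measurable_power)
  have odd: "(\<integral>x. (S x ^ 3 * a j x + S x * a j x ^ 3) * x (s j) \<partial>C I) = 0"
    using j bm unfolding C_def
    by (intro integral_odd_zero[of "s j"])
      (auto simp: C_def[symmetric] S_flip a_flip
        intro!: bounded_measurable_measurable bounded_measurable_intros)
  have pos: "0 \<le> (\<integral>x. a j x ^ 4 \<partial>C I)"
    by (rule integral_nonneg_AE) (simp add: zero_le_even_power)
  have "(\<integral>x. (\<Sum>k\<in>insert j K. a k x * x (s k)) ^ 4 \<partial>C I)
      = (\<integral>x. S x ^ 4 + (4 * ((S x ^ 3 * a j x + S x * a j x ^ 3) * x (s j))
          + (6 * ((S x)\<^sup>2 * (a j x)\<^sup>2) + a j x ^ 4)) \<partial>C I)"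
  proof (rule Bochner_Integration.integral_cong)
    fix x assume x: "x \<in> space (C I)"
    have e: "x (s j) = -1 \<or> x (s j) = 1"
      using cantor_cube_coord[of x I "s j"] x j unfolding C_def by auto
    have "(a j x * x (s j) + S x) ^ 4 = S x ^ 4 + (4 * ((S x ^ 3 * a j x + S x * a j x ^ 3) * x (s j))
          + (6 * ((S x)\<^sup>2 * (a j x)\<^sup>2) + a j x ^ 4))"
      using e by (elim disjE) (simp_all add: power2_eq_square power3_eq_cube power4_eq_xxxx algebra_simps)
    then show "(\<Sum>k\<in>insert j K. a k x * x (s k)) ^ 4
        = S x ^ 4 + (4 * ((S x ^ 3 * a j x + S x * a j x ^ 3) * x (s j))
          + (6 * ((S x)\<^sup>2 * (a j x)\<^sup>2) + a j x ^ 4))"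
      using insert.hyps by (simp add: S_eq)
  qed simp
  also have "\<dots> = (\<integral>x. S x ^ 4 \<partial>C I)
      + (4 * (\<integral>x. (S x ^ 3 * a j x + S x * a j x ^ 3) * x (s j) \<partial>C I)
          + (6 * (\<integral>x. (S x)\<^sup>2 * (a j x)\<^sup>2 \<partial>C I) + (\<integral>x. a j x ^ 4 \<partial>C I)))"
    using bm by (simp add: bounded_measurable_integrable bounded_measurable_intros)
  also have "\<dots> \<le> 3 * (\<integral>x. (V x)\<^sup>2 \<partial>C I)
      + (6 * (\<integral>x. V x * (a j x)\<^sup>2 \<partial>C I) + 3 * (\<integral>x. a j x ^ 4 \<partial>C I))"
    unfolding odd second using IH pos by linarith
  also have "\<dots> = 3 * (\<integral>x. (V x)\<^sup>2 + (2 * (V x * (a j x)\<^sup>2) + a j x ^ 4) \<partial>C I)"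
    using bm by (simp add: bounded_measurable_integrable bounded_measurable_intros)
  also have "(\<integral>x. (V x)\<^sup>2 + (2 * (V x * (a j x)\<^sup>2) + a j x ^ 4) \<partial>C I)
      = (\<integral>x. (\<Sum>k\<in>insert j K. (a k x)\<^sup>2)\<^sup>2 \<partial>C I)"
    using insert.hyps
    by (intro Bochner_Integration.integral_cong)
      (simp_all add: V_eq power2_sum algebra_simps flip: power_mult)
  finally show ?case .
qed simp

text \<open>A second moment \<open>L\<close> with a comparable fourth moment cannot be concentrated
  on a small set. Integrating a pointwise bound for S^2 gives L \<le> L/4 + L/2 + (3 L/2) P, where P
  is the probability in question; hence 1/6.\<close>

lemma paley_zygmund:
  fixes S :: "'a \<Rightarrow> real"
  assumes "prob_space M" and S: "S \<in> bounded_measurable M" and L: "L > 0"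
    and m2: "(\<integral>x. (S x)\<^sup>2 \<partial>M) = L" and m4: "(\<integral>x. S x ^ 4 \<partial>M) \<le> 3 * L\<^sup>2"
  shows "1 / 6 \<le> measure M {x \<in> space M. sqrt L / 2 < \<bar>S x\<bar>}"
proof -
  interpret prob_space M by fact
  let ?A = "{x \<in> space M. sqrt L / 2 < \<bar>S x\<bar>}"
  have [measurable]: "S \<in> borel_measurable M"
    using S by (rule bounded_measurable_measurable)
  have A: "?A \<in> sets M" by measurable
  \<comment> \<open>On \<open>?A\<close> this is 2 u v \<le> u^2 + v^2 for S^2 and 3 L, divided by 6
    L; the choice 3 L makes the fourth moment contribute at most L/2. Off \<open>?A\<close> the
    first term alone suffices.\<close>
  have pw: "(S x)\<^sup>2 \<le> L / 4 + (S x ^ 4 / (6 * L) + 3 * L / 2 * indicator ?A x)" if "x \<in> space M" for x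
  proof (cases "x \<in> ?A")
    case True
    have "0 \<le> ((S x)\<^sup>2 - 3 * L)\<^sup>2 / (6 * L)" using L by simp
    also have "\<dots> = S x ^ 4 / (6 * L) + 3 * L / 2 - (S x)\<^sup>2"
      using L by (simp add: field_simps power2_eq_square power4_eq_xxxx)
    finally show ?thesis using True L by simp
  next
    case False
    then have "\<bar>S x\<bar> \<le> sqrt L / 2" using that by auto
    then have "\<bar>S x\<bar>\<^sup>2 \<le> (sqrt L / 2)\<^sup>2" by (intro power_mono) auto
    then have "(S x)\<^sup>2 \<le> L / 4" using L by (simp add: power_divide)
    moreover have "0 \<le> S x ^ 4 / (6 * L)" using L by (simp add: zero_le_even_power)
    ultimately show ?thesis using False by simp
  qed
  have int: "integrable M (\<lambda>x. S x ^ n)" for n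
    using S by (intro bounded_measurable_integrable bounded_measurable_intros)
  have iA: "integrable M (indicator ?A :: 'a \<Rightarrow> real)"
    using A by (simp add: integrable_indicator_iff emeasure_eq_measure)
  have "L \<le> (\<integral>x. L / 4 + (S x ^ 4 / (6 * L) + 3 * L / 2 * indicator ?A x) \<partial>M)"
    unfolding m2[symmetric] by (rule integral_mono) (use pw int iA m2 in auto)
  also have "\<dots> = L / 4 + ((\<integral>x. S x ^ 4 \<partial>M) / (6 * L) + 3 * L / 2 * measure M ?A)"
    using int iA A by (simp add: prob_space)
  also have "\<dots> \<le> L / 4 + (3 * L\<^sup>2 / (6 * L) + 3 * L / 2 * measure M ?A)"
    using m4 L by (intro add_mono divide_right_mono) auto
  also have "3 * L\<^sup>2 / (6 * L) = L / 2" using L by (simp add: field_simps power2_eq_square)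
  finally have "L * (1 / 6) \<le> L * measure M ?A" by simp
  then show ?thesis using L by (simp only: mult_le_cancel_left_pos)
qed

section \<open>Weak norms\<close>

text \<open>Taking p-th powers level by level replaces the supremum by tail bounds, the form in
  which the norm estimates below are proved and used. A finite bound \<open>K\<close> excludes level
  sets of infinite measure on both sides.\<close>

lemma weak_norm_le_iff:
  assumes p: "0 < p" and K: "0 \<le> K"
  shows "weak_norm M p f \<le> ennreal K \<longleftrightarrow>
    (\<forall>t>0. emeasure M {x \<in> space M. t < \<bar>f x\<bar>} \<le> ennreal ((K / t) powr p))"
proof -
  have "(let m = emeasure M {x \<in> space M. t < \<bar>f x\<bar>} in
        if m = \<infinity> then \<infinity> else ennreal (t * enn2real m powr (1 / p))) \<le> ennreal K
    \<longleftrightarrow> emeasure M {x \<in> space M. t < \<bar>f x\<bar>} \<le> ennreal ((K / t) powr p)"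
    if t: "t > 0" for t
  proof (cases "emeasure M {x \<in> space M. t < \<bar>f x\<bar>}")
    case (real r)
    have "t * r powr (1 / p) \<le> K \<longleftrightarrow> r powr (1 / p) \<le> K / t"
      using t by (simp add: field_simps)
    also have "\<dots> \<longleftrightarrow> (r powr (1 / p)) powr p \<le> (K / t) powr p"
      using p K t by (metis less_eq_real_def powr_less_mono2 powr_mono2 divide_nonneg_pos linorder_not_le powr_ge_zero)
    also have "(r powr (1 / p)) powr p = r"
      using p real by (simp add: powr_powr)
    finally show ?thesis
      using real K by (simp add: Let_def)
  qed (simp add: top_unique)
  then show ?thesis
    unfolding weak_norm_def SUP_le_iff by (auto simp del: infinity_ennreal_def)
qed

lemma weak_norm_leD:
  "weak_norm M p f \<le> ennreal K \<Longrightarrow> 0 < p \<Longrightarrow> 0 \<le> K \<Longrightarrow> 0 < t \<Longrightarrow>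
    emeasure M {x \<in> space M. t < \<bar>f x\<bar>} \<le> ennreal ((K / t) powr p)"
  by (simp add: weak_norm_le_iff)

lemma weak_norm_mono_scaled:
  assumes p: "0 < p" and B: "0 < B" and K: "0 \<le> K"
    and h: "h \<in> borel_measurable M" "weak_norm M p h \<le> ennreal K"
    and le: "\<And>x. x \<in> space M \<Longrightarrow> \<bar>f x\<bar> \<le> B * \<bar>h x\<bar>"
  shows "weak_norm M p f \<le> ennreal (B * K)"
proof (subst weak_norm_le_iff)
  show "\<forall>t>0. emeasure M {x \<in> space M. t < \<bar>f x\<bar>} \<le> ennreal ((B * K / t) powr p)"
  proof (intro allI impI)
    fix t :: real assume t: "t > 0"
    have sub: "{x \<in> space M. t < \<bar>f x\<bar>} \<subseteq> {x \<in> space M. t / B < \<bar>h x\<bar>}"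
    proof safe
      fix x assume "x \<in> space M" "t < \<bar>f x\<bar>"
      then have "t < B * \<bar>h x\<bar>" using le[of x] by linarith
      then show "t / B < \<bar>h x\<bar>" using B by (simp add: field_simps)
    qed
    have "{x \<in> space M. t / B < \<bar>h x\<bar>} \<in> sets M" using h(1) by measurable
    then have "emeasure M {x \<in> space M. t < \<bar>f x\<bar>} \<le> emeasure M {x \<in> space M. t / B < \<bar>h x\<bar>}"
      by (rule emeasure_mono[OF sub])
    also have "\<dots> \<le> ennreal ((K / (t / B)) powr p)"
      using t B by (intro weak_norm_leD h(2) p K) simp
    finally show "emeasure M {x \<in> space M. t < \<bar>f x\<bar>} \<le> ennreal ((B * K / t) powr p)"
      by (simp add: mult.commute)
  qed
qed (use p B K in auto)

lemma (in prob_space) bounded_measurable_Lp_weak: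
  assumes f: "f \<in> bounded_measurable M" and p: "0 < p"
  shows "f \<in> Lp_weak M p"
proof -
  obtain B where B: "\<And>x. x \<in> space M \<Longrightarrow> \<bar>f x\<bar> \<le> B"
    using f unfolding bounded_measurable_def by blast
  have "weak_norm M p f \<le> ennreal \<bar>B\<bar>"
  proof (subst weak_norm_le_iff)
    show "\<forall>t>0. emeasure M {x \<in> space M. t < \<bar>f x\<bar>} \<le> ennreal ((\<bar>B\<bar> / t) powr p)"
    proof (intro allI impI)
      fix t :: real assume t: "t > 0"
      show "emeasure M {x \<in> space M. t < \<bar>f x\<bar>} \<le> ennreal ((\<bar>B\<bar> / t) powr p)"
      proof (cases "t < \<bar>B\<bar>")
        case True
        then have "1 \<le> (\<bar>B\<bar> / t) powr p" using t p by (intro ge_one_powr_ge_zero) auto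
        then have "1 \<le> ennreal ((\<bar>B\<bar> / t) powr p)" by simp
        then show ?thesis using emeasure_le_1 order_trans by blast
      next
        case False
        then have "{x \<in> space M. t < \<bar>f x\<bar>} = {}" using B by force
        then show ?thesis by (simp only: emeasure_empty zero_le)
      qed
    qed
  qed (use p in auto)
  then show ?thesis
    using bounded_measurable_measurable[OF f] by (auto simp: Lp_weak_def top.not_eq_extremum less_top intro: le_less_trans)
qed

section \<open>Tails of disjoint sums and of sums of coordinates\<close>

text \<open>Almost everywhere at most one \<open>f k\<close> is nonzero and \<open>F\<close>
  coincides with it, so the indicator of the level set of \<open>F\<close> is the sum of the others;
  as \<open>t\<close> is positive, vanishing functions contribute nothing. \<open>F\<close> has to
  equal the sum only almost everywhere because \<open>T\<close> is linear only in that
  sense.\<close>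

lemma emeasure_disjoint_sum:
  fixes f :: "'k \<Rightarrow> 'a \<Rightarrow> real"
  assumes K: "finite K" and f: "\<And>k. k \<in> K \<Longrightarrow> f k \<in> borel_measurable M"
    and disj: "\<And>k l. k \<in> K \<Longrightarrow> l \<in> K \<Longrightarrow> k \<noteq> l \<Longrightarrow> AE x in M. f k x = 0 \<or> f l x = 0"
    and F: "F \<in> borel_measurable M" "AE x in M. F x = (\<Sum>k\<in>K. f k x)" and t: "0 < t"
  shows "emeasure M {x \<in> space M. t < \<bar>F x\<bar>} = (\<Sum>k\<in>K. emeasure M {x \<in> space M. t < \<bar>f k x\<bar>})"
proof -
  have sets: "{x \<in> space M. t < \<bar>F x\<bar>} \<in> sets M" "k \<in> K \<Longrightarrow> {x \<in> space M. t < \<bar>f k x\<bar>} \<in> sets M" for k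
    using f[of k] F(1) by measurable
  have "AE x in M. \<forall>k\<in>K. \<forall>l\<in>K. k \<noteq> l \<longrightarrow> f k x = 0 \<or> f l x = 0"
    using K disj by (intro AE_finite_allI) (auto simp: AE_conj_iff)
  then have "AE x in M. (indicator {x \<in> space M. t < \<bar>F x\<bar>} x :: ennreal)
      = (\<Sum>k\<in>K. indicator {x \<in> space M. t < \<bar>f k x\<bar>} x)"
    using F(2)
  proof eventually_elim
    case (elim x)
    show ?case
    proof (cases "\<exists>k\<in>K. f k x \<noteq> 0")
      case False
      then show ?thesis using elim(2) t by (auto simp: indicator_def)
    next
      case True
      then obtain j where j: "j \<in> K" "f j x \<noteq> 0" by blast
      have z: "f k x = 0" if "k \<in> K - {j}" for k
        using elim(1) j that by auto
      have "F x = f j x"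
        using elim(2) sum.remove[OF K j(1), of "\<lambda>k. f k x"] z by simp
      moreover have "(\<Sum>k\<in>K. indicator {x \<in> space M. t < \<bar>f k x\<bar>} x :: ennreal)
          = indicator {x \<in> space M. t < \<bar>f j x\<bar>} x"
        using sum.remove[OF K j(1), of "\<lambda>k. indicator {x \<in> space M. t < \<bar>f k x\<bar>} x :: ennreal"] z t
        by (simp add: indicator_def)
      ultimately show ?thesis by (simp add: indicator_def)
    qed
  qed
  then have "(\<integral>\<^sup>+x. indicator {x \<in> space M. t < \<bar>F x\<bar>} x \<partial>M)
      = (\<integral>\<^sup>+x. (\<Sum>k\<in>K. indicator {x \<in> space M. t < \<bar>f k x\<bar>} x) \<partial>M)"
    by (rule nn_integral_cong_AE)
  also have "\<dots> = (\<Sum>k\<in>K. \<integral>\<^sup>+x. indicator {x \<in> space M. t < \<bar>f k x\<bar>} x \<partial>M)"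
    using sets(2) by (intro nn_integral_sum) auto
  finally show ?thesis using sets by simp
qed

lemma rademacher_tail:
  assumes K: "finite K" "K \<subseteq> I" and t: "0 < t"
  shows "measure (cantor_cube I) {x \<in> space (cantor_cube I). t < \<bar>\<Sum>i\<in>K. x i\<bar>} \<le> card K / t\<^sup>2"
proof -
  interpret prob_space "cantor_cube I" by (rule prob_space_cantor_cube)
  let ?C = "cantor_cube I" and ?R = "\<lambda>x. \<Sum>i\<in>K. x i :: real"
  have R: "?R \<in> bounded_measurable ?C"
    using K by (intro bounded_measurable_sum bounded_measurable_coord) auto
  have [measurable]: "?R \<in> borel_measurable ?C"
    using R by (rule bounded_measurable_measurable)
  have int: "integrable ?C (\<lambda>x. (?R x)\<^sup>2)"
    using R by (intro bounded_measurable_integrable bounded_measurable_power)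
  have m2: "(\<integral>x. (?R x)\<^sup>2 \<partial>?C) = card K"
    using rademacher_second_moment[of K "\<lambda>i. i" I "\<lambda>_ _. 1" "\<lambda>_. 1"] K
    by (simp add: bounded_measurable_const prob_space)
  have "measure ?C {x \<in> space ?C. t < \<bar>?R x\<bar>} \<le> measure ?C {x \<in> space ?C. t\<^sup>2 \<le> (?R x)\<^sup>2}"
  proof (rule finite_measure_mono)
    show "{x \<in> space ?C. t < \<bar>?R x\<bar>} \<subseteq> {x \<in> space ?C. t\<^sup>2 \<le> (?R x)\<^sup>2}"
      using t by (auto simp: abs_le_square_iff[symmetric])
  qed measurable
  also have "\<dots> \<le> (\<integral>x. (?R x)\<^sup>2 \<partial>?C) / t\<^sup>2"
    using int t by (intro integral_Markov_inequality_measure[where A = "{}"]) auto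
  finally show ?thesis unfolding m2 .
qed

text \<open>Chebyshev bounds the tail by (sqrt n / t)^2. Where sqrt n / t is below 1, lowering the
  exponent from 2 to \<open>p\<close> only increases the bound; elsewhere the bound exceeds 1 and
  holds trivially.\<close>

lemma weak_norm_rademacher_sum_le2:
  assumes K: "finite K" "K \<subseteq> I" and p: "0 < p" "p \<le> 2"
  shows "weak_norm (cantor_cube I) p (\<lambda>x. \<Sum>i\<in>K. x i) \<le> ennreal (sqrt (card K))"
proof (subst weak_norm_le_iff)
  interpret prob_space "cantor_cube I" by (rule prob_space_cantor_cube)
  show "\<forall>t>0. emeasure (cantor_cube I) {x \<in> space (cantor_cube I). t < \<bar>\<Sum>i\<in>K. x i\<bar>}
      \<le> ennreal ((sqrt (card K) / t) powr p)"
  proof (intro allI impI)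
    fix t :: real assume t: "t > 0"
    have "prob {x \<in> space (cantor_cube I). t < \<bar>\<Sum>i\<in>K. x i\<bar>} \<le> (sqrt (card K) / t) powr p"
    proof (cases "1 \<le> sqrt (card K) / t")
      case True
      then have "1 \<le> (sqrt (card K) / t) powr p" using p by (intro ge_one_powr_ge_zero) auto
      then show ?thesis using prob_le_1 order_trans by blast
    next
      case False
      have "prob {x \<in> space (cantor_cube I). t < \<bar>\<Sum>i\<in>K. x i\<bar>} \<le> (sqrt (card K) / t)\<^sup>2"
        using rademacher_tail[OF K t] by (simp add: power_divide)
      also have "\<dots> = (sqrt (card K) / t) powr 2"
        using t by simp
      also have "\<dots> \<le> (sqrt (card K) / t) powr p"
        using False p t by (intro powr_mono') auto
      finally show ?thesis .
    qed
    then show "emeasure (cantor_cube I) {x \<in> space (cantor_cube I). t < \<bar>\<Sum>i\<in>K. x i\<bar>}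
      \<le> ennreal ((sqrt (card K) / t) powr p)"
      by (simp add: emeasure_eq_measure)
  qed
qed (use p in auto)

text \<open>The sum never exceeds n in absolute value, so only levels t < n matter; there t powr (p
  - 2) \<le> n powr (p - 2) upgrades the Chebyshev bound to a p-th power. The exponent is cruder
  than that of Khintchine's inequality, but any exponent below 1 serves the purpose.\<close>

lemma weak_norm_rademacher_sum_ge2:
  assumes K: "finite K" "K \<subseteq> I" and p: "2 \<le> p"
  shows "weak_norm (cantor_cube I) p (\<lambda>x. \<Sum>i\<in>K. x i) \<le> ennreal (card K powr (1 - 1 / p))"
proof (subst weak_norm_le_iff)
  interpret prob_space "cantor_cube I" by (rule prob_space_cantor_cube)
  let ?n = "real (card K)"
  show "\<forall>t>0. emeasure (cantor_cube I) {x \<in> space (cantor_cube I). t < \<bar>\<Sum>i\<in>K. x i\<bar>}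
      \<le> ennreal ((?n powr (1 - 1 / p) / t) powr p)"
  proof (intro allI impI)
    fix t :: real assume t: "t > 0"
    have "prob {x \<in> space (cantor_cube I). t < \<bar>\<Sum>i\<in>K. x i\<bar>} \<le> (?n powr (1 - 1 / p) / t) powr p"
    proof (cases "t < ?n")
      case False
      have "{x \<in> space (cantor_cube I). t < \<bar>\<Sum>i\<in>K. x i\<bar>} = {}"
      proof safe
        fix x assume x: "x \<in> space (cantor_cube I)" "t < \<bar>\<Sum>i\<in>K. x i\<bar>"
        have "\<bar>\<Sum>i\<in>K. x i\<bar> \<le> (\<Sum>i\<in>K. \<bar>x i\<bar>)" by (rule sum_abs)
        also have "\<dots> \<le> (\<Sum>i\<in>K. 1)"
          using cantor_cube_coord[OF x(1)] K by (intro sum_mono) fastforce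
        finally show "x \<in> {}" using x(2) False by simp
      qed
      then show ?thesis by (simp only: measure_empty powr_ge_zero)
    next
      case True
      have "prob {x \<in> space (cantor_cube I). t < \<bar>\<Sum>i\<in>K. x i\<bar>} \<le> ?n / t\<^sup>2"
        by (rule rademacher_tail[OF K t])
      also have "\<dots> = ?n * t powr (p - 2) / t powr p"
        using t by (simp add: powr_diff)
      also have "\<dots> \<le> ?n * ?n powr (p - 2) / t powr p"
        using True p t by (intro divide_right_mono mult_left_mono powr_mono2) auto
      also have "?n * ?n powr (p - 2) = ?n powr (p - 1)"
        using True t powr_add[of ?n 1 "p - 2"] by simp
      also have "?n powr (p - 1) = (?n powr (1 - 1 / p)) powr p"
        using p by (simp add: powr_powr algebra_simps)
      finally show ?thesis using t by (simp add: powr_divide)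
    qed
    then show "emeasure (cantor_cube I) {x \<in> space (cantor_cube I). t < \<bar>\<Sum>i\<in>K. x i\<bar>}
      \<le> ennreal ((?n powr (1 - 1 / p) / t) powr p)"
      by (simp add: emeasure_eq_measure)
  qed
qed (use p in auto)

section \<open>Atoms\<close>

text \<open>Inside an atom a measurable condition holds almost everywhere or almost nowhere. If all
  the sets where \<open>\<sigma> * f\<close> exceeds 1 / Suc m were null in \<open>A\<close>, then
  \<open>f\<close> would vanish there; so one of them is full. The point is that the possible pairs
  of \<open>m\<close> and \<open>\<sigma>\<close> are countable in number.\<close>

lemma atom_nonzero_function:
  fixes f :: "'a \<Rightarrow> real"
  assumes A: "is_atom M A" and f [measurable]: "f \<in> borel_measurable M"
    and nz: "\<not> (AE x in M. x \<in> A \<longrightarrow> f x = 0)"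
  shows "\<exists>m::nat. \<exists>\<sigma>\<in>{-1, 1}. AE x in M. x \<in> A \<longrightarrow> 1 / Suc m < \<sigma> * f x"
proof (rule ccontr)
  assume "\<not> ?thesis"
  then have H: "\<not> (AE x in M. x \<in> A \<longrightarrow> 1 / Suc m < \<sigma> * f x)" if "\<sigma> \<in> {-1, 1}" for m \<sigma>
    using that by blast
  have [measurable]: "A \<in> sets M" using A by (simp add: is_atom_def)
  have "AE x in M. x \<in> A \<longrightarrow> \<not> 1 / Suc m < \<sigma> * f x" if \<sigma>: "\<sigma> \<in> {-1, 1}" for m \<sigma>
  proof -
    let ?B = "{x \<in> space M. x \<in> A \<and> 1 / Suc m < \<sigma> * f x}"
    have B: "?B \<in> sets M" by measurable
    have "?B \<subseteq> A" by auto
    with B A have "emeasure M ?B = 0 \<or> emeasure M (A - ?B) = 0"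
      unfolding is_atom_def by blast
    moreover have "emeasure M (A - ?B) \<noteq> 0"
    proof
      assume "emeasure M (A - ?B) = 0"
      then have "A - ?B \<in> null_sets M" using B by (intro null_setsI) auto
      then have "AE x in M. x \<notin> A - ?B" by (rule AE_not_in)
      then have "AE x in M. x \<in> A \<longrightarrow> 1 / Suc m < \<sigma> * f x" by (rule AE_mp) (auto intro: AE_I2)
      then show False using H[OF \<sigma>] by blast
    qed
    ultimately have "?B \<in> null_sets M" using B by (intro null_setsI) auto
    then have "AE x in M. x \<notin> ?B" by (rule AE_not_in)
    then show ?thesis by (rule AE_mp) (auto intro: AE_I2)
  qed
  then have "AE x in M. \<forall>m. \<forall>\<sigma>\<in>{-1, 1}. x \<in> A \<longrightarrow> \<not> 1 / Suc m < \<sigma> * f x"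
    by (subst AE_all_countable, intro allI AE_finite_allI) auto
  then have "AE x in M. x \<in> A \<longrightarrow> f x = 0"
  proof eventually_elim
    case (elim x)
    show ?case
    proof (intro impI, rule ccontr)
      assume x: "x \<in> A" "f x \<noteq> 0"
      obtain m where "1 / Suc m < \<bar>f x\<bar>"
        using x(2) nat_approx_posE[of "\<bar>f x\<bar>"] by (metis zero_less_abs_iff)
      moreover have "\<not> 1 / Suc m < f x" "\<not> 1 / Suc m < - f x"
        using elim[rule_format, of 1 m] elim[rule_format, of "-1" m] x by auto
      ultimately show False by (simp add: abs_if split: if_splits)
    qed
  qed
  then show False using nz by blast
qed

text \<open>Exhaust B by atoms. What remains contains no atom, but since the \<sigma>-algebra is generated by
  atoms and null sets, each measurable set is trivial on it; so it would be an atom itself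
  were it not null.\<close>

lemma purely_atomic_cover:
  assumes M: "purely_atomic M" and B: "B \<in> sets M" "emeasure M B < \<infinity>"
  shows "\<exists>\<A>. countable \<A> \<and> (\<forall>A\<in>\<A>. is_atom M A \<and> emeasure M A < \<infinity>) \<and> B - \<Union>\<A> \<in> null_sets M"
proof -
  define F where "F = {\<A>. countable \<A> \<and> (\<forall>A\<in>\<A>. is_atom M A \<and> A \<subseteq> B)}"
  have F_sets: "\<Union>\<A> \<in> sets M" if "\<A> \<in> F" for \<A>
    using that unfolding F_def by (intro sets.countable_Union) (auto simp: is_atom_def)
  have F_sub: "\<Union>\<A> \<subseteq> B" if "\<A> \<in> F" for \<A>
    using that unfolding F_def by auto
  have "{} \<in> F" unfolding F_def by auto
  then have "(\<lambda>\<A>. emeasure M (\<Union>\<A>)) ` F \<noteq> {}" by blast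
  from ennreal_Sup_countable_SUP[OF this] obtain e :: "nat \<Rightarrow> ennreal"
    where e: "range e \<subseteq> (\<lambda>\<A>. emeasure M (\<Union>\<A>)) ` F" "(SUP \<A>\<in>F. emeasure M (\<Union>\<A>)) = (SUP n. e n)"
    by auto
  then have "\<forall>n. \<exists>\<A>\<in>F. e n = emeasure M (\<Union>\<A>)" by blast
  then obtain a where a: "\<And>n. a n \<in> F" "\<And>n. e n = emeasure M (\<Union>(a n))" by metis
  \<comment> \<open>Merging a maximizing sequence of countable families gives a countable family
    again, so the supremum is attained.\<close>
  define \<A> where "\<A> = (\<Union>n. a n)"
  have \<A>: "\<A> \<in> F" using a(1) unfolding \<A>_def F_def by auto
  have max: "emeasure M (\<Union>\<B>) \<le> emeasure M (\<Union>\<A>)" if "\<B> \<in> F" for \<B>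
  proof -
    have "emeasure M (\<Union>\<B>) \<le> (SUP n. e n)"
      unfolding e(2)[symmetric] using that by (rule SUP_upper)
    also have "\<dots> \<le> emeasure M (\<Union>\<A>)"
      unfolding a(2) using F_sets[OF \<A>] by (intro SUP_least emeasure_mono) (auto simp: \<A>_def)
    finally show ?thesis .
  qed
  define R where "R = B - \<Union>\<A>"
  have R: "R \<in> sets M" using B F_sets[OF \<A>] unfolding R_def by auto
  have no_atom: "\<not> is_atom M A" if "A \<subseteq> R" for A
  proof
    assume A: "is_atom M A"
    have "insert A \<A> \<in> F" using \<A> A that unfolding F_def R_def by auto
    then have "emeasure M (A \<union> \<Union>\<A>) \<le> emeasure M (\<Union>\<A>)" using max by force
    moreover have "emeasure M (A \<union> \<Union>\<A>) = emeasure M A + emeasure M (\<Union>\<A>)"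
      using A F_sets[OF \<A>] that by (intro plus_emeasure[symmetric]) (auto simp: is_atom_def R_def)
    moreover have "emeasure M (\<Union>\<A>) \<noteq> \<infinity>"
      using emeasure_mono[OF F_sub[OF \<A>] B(1)] B(2) by auto
    ultimately have "emeasure M A = 0"
      by (metis add.commute add.right_neutral ennreal_add_left_cancel_le infinity_ennreal_def le_zero_eq)
    then show False using A by (simp add: is_atom_def)
  qed
  \<comment> \<open>Being null or co-null in \<open>R\<close> passes to complements and countable
    unions, so it is enough to check generators. For a generating atom \<open>E\<close>, a non-null
    \<open>R \<inter> E\<close> would itself be an atom inside \<open>R\<close>.\<close>
  have trivial: "emeasure M (R \<inter> E) = 0 \<or> emeasure M (R - E) = 0" if "E \<in> sets M" for E
  proof -
    have "E \<in> sigma_sets (space M) ({A. is_atom M A} \<union> null_sets M)"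
      using that M unfolding purely_atomic_def by simp
    then show ?thesis
    proof (induction E rule: sigma_sets.induct)
      case (Basic E)
      show ?case
      proof (cases "is_atom M E")
        case True
        have RE: "R \<inter> E \<in> sets M" using R True by (auto simp: is_atom_def)
        have "is_atom M (R \<inter> E)" if nz: "emeasure M (R \<inter> E) \<noteq> 0"
          unfolding is_atom_def
        proof (intro conjI ballI impI)
          fix D assume D: "D \<in> sets M" "D \<subseteq> R \<inter> E"
          then have "emeasure M D = 0 \<or> emeasure M (E - D) = 0"
            using True unfolding is_atom_def by blast
          moreover have "emeasure M (R \<inter> E - D) \<le> emeasure M (E - D)"
            using True D by (intro emeasure_mono) (auto simp: is_atom_def)
          ultimately show "emeasure M D = 0 \<or> emeasure M (R \<inter> E - D) = 0" by auto
        qed (use RE nz in \<open>auto simp: zero_less_iff_neq_zero\<close>)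
        then show ?thesis using no_atom[of "R \<inter> E"] by auto
      next
        case False
        then have "E \<in> null_sets M" using Basic by auto
        then show ?thesis using null_setsD1[OF null_set_Int1[OF _ R]] by blast
      qed
    next
      case (Compl E)
      have "R \<inter> (space M - E) = R - E" "R - (space M - E) = R \<inter> E"
        using sets.sets_into_space[OF R] by auto
      then show ?case using Compl.IH by auto
    next
      case (Union E)
      have E: "E i \<in> sets M" for i
        using Union.hyps M unfolding purely_atomic_def by simp
      show ?case
      proof (cases "\<exists>i. emeasure M (R - E i) = 0")
        case True
        then obtain i where "emeasure M (R - E i) = 0" by blast
        moreover have "emeasure M (R - (\<Union>i. E i)) \<le> emeasure M (R - E i)"
          using R E by (intro emeasure_mono) auto
        ultimately show ?thesis by auto
      next
        case False
        then have "R \<inter> E i \<in> null_sets M" for i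
          using Union.IH[of i] R E by (intro null_setsI) auto
        then have "(\<Union>i. R \<inter> E i) \<in> null_sets M" by (rule null_sets_UN)
        then show ?thesis by auto
      qed
    qed simp
  qed
  have "emeasure M R = 0"
  proof (rule ccontr)
    assume "emeasure M R \<noteq> 0"
    moreover have "emeasure M D = 0 \<or> emeasure M (R - D) = 0" if "D \<in> sets M" "D \<subseteq> R" for D
      using trivial[OF that(1)] that(2) by (simp add: Int_absorb1)
    ultimately have "is_atom M R" using R by (auto simp: is_atom_def zero_less_iff_neq_zero)
    then show False using no_atom by blast
  qed
  moreover have "emeasure M A < \<infinity>" if "A \<in> \<A>" for A
    using \<A> that B emeasure_mono[of A B M] by (auto simp: F_def intro: le_less_trans)
  ultimately show ?thesis
    using \<A> R unfolding F_def R_def by (intro exI[of _ \<A>]) (auto intro: null_setsI)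
qed

section \<open>Embeddings of the cube\<close>

text \<open>The common factor \<open>g\<close> comes out of the sum, which reduces the claim to the
  two estimates for plain sums of coordinates. The exponent is fixed before \<open>K\<close>,
  \<open>g\<close> and \<open>B\<close>, so that the number of terms may tend to infinity
  afterwards.\<close>

lemma weak_norm_scaled_rademacher_sum:
  fixes I :: "'i set"
  assumes p: "1 < p"
  shows "\<exists>\<theta><1. \<forall>K\<subseteq>I. finite K \<longrightarrow> (\<forall>g B. 0 < B \<longrightarrow> (\<forall>x\<in>space (cantor_cube I). \<bar>g x\<bar> \<le> B) \<longrightarrow>
    weak_norm (cantor_cube I) p (\<lambda>x. \<Sum>i\<in>K. g x * x i) \<le> ennreal (B * card K powr \<theta>))"
proof -
  define \<theta> where "\<theta> = (if p \<le> 2 then 1 / 2 else 1 - 1 / p)"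
  have "\<theta> < 1" using p by (auto simp: \<theta>_def)
  moreover have "weak_norm (cantor_cube I) p (\<lambda>x. \<Sum>i\<in>K. g x * x i) \<le> ennreal (B * card K powr \<theta>)"
    if K: "K \<subseteq> I" "finite K" and B: "0 < B" "\<forall>x\<in>space (cantor_cube I). \<bar>g x\<bar> \<le> B" for K g B
  proof (rule weak_norm_mono_scaled)
    show "weak_norm (cantor_cube I) p (\<lambda>x. \<Sum>i\<in>K. x i) \<le> ennreal (card K powr \<theta>)"
      using weak_norm_rademacher_sum_le2[of K I p] weak_norm_rademacher_sum_ge2[of K I p] K p
      by (auto simp: \<theta>_def powr_half_sqrt)
    show "(\<lambda>x. \<Sum>i\<in>K. x i) \<in> borel_measurable (cantor_cube I)"
      using K by (intro borel_measurable_sum measurable_coord) auto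
    show "\<bar>\<Sum>i\<in>K. g x * x i\<bar> \<le> B * \<bar>\<Sum>i\<in>K. x i\<bar>" if "x \<in> space (cantor_cube I)" for x
      using B(2) that by (simp add: sum_distrib_left[symmetric] abs_mult mult_right_mono)
  qed (use p B in auto)
  ultimately show ?thesis by (intro exI[of _ \<theta>]) auto
qed

text \<open>The embedding as seen by bounded functions only. Equality of images is always almost
  everywhere, since \<open>T\<close> acts on representatives.\<close>

locale cube_embedding =
  fixes p c C :: real and I :: "'i set" and M :: "'a measure"
    and T :: "(('i \<Rightarrow> real) \<Rightarrow> real) \<Rightarrow> 'a \<Rightarrow> real"
  assumes p: "1 < p" and c: "0 < c" and C: "0 < C"
    and T_measurable: "f \<in> bounded_measurable (cantor_cube I) \<Longrightarrow> T f \<in> borel_measurable M"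
    and lower: "f \<in> bounded_measurable (cantor_cube I) \<Longrightarrow>
      ennreal c * weak_norm (cantor_cube I) p f \<le> weak_norm M p (T f)"
    and upper: "f \<in> bounded_measurable (cantor_cube I) \<Longrightarrow>
      weak_norm M p (T f) \<le> ennreal C * weak_norm (cantor_cube I) p f"
    and finite_norm: "f \<in> bounded_measurable (cantor_cube I) \<Longrightarrow> weak_norm M p (T f) < \<infinity>"
    and linear: "f \<in> bounded_measurable (cantor_cube I) \<Longrightarrow> g \<in> bounded_measurable (cantor_cube I) \<Longrightarrow>
      AE y in M. T (\<lambda>x. a * f x + b * g x) y = a * T f y + b * T g y"
begin

lemma T_sum:
  assumes "finite K" "\<And>k. k \<in> K \<Longrightarrow> f k \<in> bounded_measurable (cantor_cube I)"
  shows "AE y in M. T (\<lambda>x. \<Sum>k\<in>K. f k x) y = (\<Sum>k\<in>K. T (f k) y)"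
  using assms
proof (induction K rule: finite_induct)
  case empty
  \<comment> \<open>That \<open>T\<close> sends the zero function to 0 almost everywhere is
    linearity with both coefficients 0.\<close>
  show ?case
    using linear[OF bounded_measurable_const[of 0] bounded_measurable_const[of 0], of 0 0] by simp
next
  case (insert j K)
  have "AE y in M. T (\<lambda>x. 1 * f j x + 1 * (\<Sum>k\<in>K. f k x)) y = 1 * T (f j) y + 1 * T (\<lambda>x. \<Sum>k\<in>K. f k x) y"
    using insert.prems by (intro linear bounded_measurable_sum) auto
  moreover have "AE y in M. T (\<lambda>x. \<Sum>k\<in>K. f k x) y = (\<Sum>k\<in>K. T (f k) y)"
    using insert.prems by (intro insert.IH) auto
  ultimately show ?case
    by eventually_elim (use insert.hyps in auto)
qed

lemma emeasure_T_le:
  assumes f: "f \<in> bounded_measurable (cantor_cube I)"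
    and K: "0 \<le> K" "weak_norm (cantor_cube I) p f \<le> ennreal K" and t: "0 < t"
  shows "emeasure M {y \<in> space M. t < \<bar>T f y\<bar>} \<le> ennreal ((C * K / t) powr p)"
proof -
  have "weak_norm M p (T f) \<le> ennreal C * ennreal K"
    using upper[OF f] mult_left_mono[OF K(2), of "ennreal C"] by (meson order_trans zero_le)
  then have "weak_norm M p (T f) \<le> ennreal (C * K)"
    using C K(1) by (simp add: ennreal_mult)
  then show ?thesis using p C K(1) t by (intro weak_norm_leD) auto
qed

lemma weak_norm_le_T:
  assumes f: "f \<in> bounded_measurable (cantor_cube I)" and K: "0 \<le> K"
    and le: "\<And>t. 0 < t \<Longrightarrow> emeasure M {y \<in> space M. t < \<bar>T f y\<bar>} \<le> ennreal ((K / t) powr p)"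
  shows "weak_norm (cantor_cube I) p f \<le> ennreal (K / c)"
proof -
  have "weak_norm M p (T f) \<le> ennreal K"
    using le weak_norm_le_iff[of p K M "T f"] p K by simp
  then have "ennreal c * weak_norm (cantor_cube I) p f \<le> ennreal K"
    using lower[OF f] by (rule order_trans[rotated])
  then have "inverse (ennreal c) * (ennreal c * weak_norm (cantor_cube I) p f) \<le> inverse (ennreal c) * ennreal K"
    by (rule mult_left_mono) simp
  moreover have "inverse (ennreal c) * (ennreal c * weak_norm (cantor_cube I) p f) = weak_norm (cantor_cube I) p f"
    using c by (simp add: mult.assoc[symmetric] inverse_ennreal ennreal_mult[symmetric])
  moreover have "inverse (ennreal c) * ennreal K = ennreal (K / c)"
    using c K by (simp add: inverse_ennreal ennreal_mult[symmetric] field_simps)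
  ultimately show ?thesis by simp
qed

lemma emeasure_T_disjoint_sum:
  assumes K: "finite K" and f: "\<And>k. k \<in> K \<Longrightarrow> f k \<in> bounded_measurable (cantor_cube I)"
    and disj: "\<And>k l. k \<in> K \<Longrightarrow> l \<in> K \<Longrightarrow> k \<noteq> l \<Longrightarrow> AE y in M. T (f k) y = 0 \<or> T (f l) y = 0"
    and t: "0 < t"
  shows "emeasure M {y \<in> space M. t < \<bar>T (\<lambda>x. \<Sum>k\<in>K. f k x) y\<bar>}
    = (\<Sum>k\<in>K. emeasure M {y \<in> space M. t < \<bar>T (f k) y\<bar>})"
proof (rule emeasure_disjoint_sum[OF K _ disj _ _ t])
  show "AE y in M. T (\<lambda>x. \<Sum>k\<in>K. f k x) y = (\<Sum>k\<in>K. T (f k) y)"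
    using K f by (rule T_sum)
qed (use f in \<open>auto intro!: T_measurable bounded_measurable_sum\<close>)

lemma bounded_measurable_scaled_coord:
  "g \<in> bounded_measurable (cantor_cube I) \<Longrightarrow> i \<in> I \<Longrightarrow>
    (\<lambda>x. g x * x i) \<in> bounded_measurable (cantor_cube I)"
  by (intro bounded_measurable_mult bounded_measurable_coord)

text \<open>Otherwise T maps some infinite family of functions g x * x i to functions that are at least
  1 / Suc m on A with a common sign. A sum of n of them is then of order n on A, although by
  square root cancellation its norm is only of order n powr \<theta> with \<theta> < 1.\<close>

lemma countable_nonzero_on_atom:
  assumes A: "is_atom M A" "emeasure M A < \<infinity>" and g: "g \<in> bounded_measurable (cantor_cube I)"
  shows "countable {i \<in> I. \<not> (AE y in M. y \<in> A \<longrightarrow> T (\<lambda>x. g x * x i) y = 0)}"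
proof -
  let ?h = "\<lambda>i x. g x * x i"
  define U where "U = (\<lambda>m \<sigma>. {i \<in> I. AE y in M. y \<in> A \<longrightarrow> 1 / Suc m < \<sigma> * T (?h i) y})"
  obtain B where "\<And>x. x \<in> space (cantor_cube I) \<Longrightarrow> \<bar>g x\<bar> \<le> B"
    using g unfolding bounded_measurable_def by blast
  \<comment> \<open>Adding 1 makes the bound strictly positive, also when \<open>g\<close>
    vanishes.\<close>
  then have "\<forall>x\<in>space (cantor_cube I). \<bar>g x\<bar> \<le> \<bar>B\<bar> + 1"
    by (meson abs_ge_self add_increasing2 order_trans zero_le_one)
  then have B: "0 < \<bar>B\<bar> + 1" "\<forall>x\<in>space (cantor_cube I). \<bar>g x\<bar> \<le> \<bar>B\<bar> + 1"
    by auto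
  obtain \<theta> where \<theta>: "\<theta> < 1" and norm: "\<And>K. K \<subseteq> I \<Longrightarrow> finite K \<Longrightarrow>
      weak_norm (cantor_cube I) p (\<lambda>x. \<Sum>i\<in>K. ?h i x) \<le> ennreal ((\<bar>B\<bar> + 1) * card K powr \<theta>)"
  proof -
    obtain \<theta> where \<theta>: "\<theta> < 1" and *: "\<forall>K\<subseteq>I. finite K \<longrightarrow> (\<forall>g B. 0 < B \<longrightarrow>
        (\<forall>x\<in>space (cantor_cube I). \<bar>g x\<bar> \<le> B) \<longrightarrow>
        weak_norm (cantor_cube I) p (\<lambda>x. \<Sum>i\<in>K. g x * x i) \<le> ennreal (B * card K powr \<theta>))"
      using weak_norm_scaled_rademacher_sum[OF p, of I] by (elim exE conjE)
    show ?thesis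
      by (rule that[OF \<theta>]) (rule *[rule_format], use B in auto)
  qed
  have h: "?h i \<in> bounded_measurable (cantor_cube I)" if "i \<in> I" for i
    using g that by (rule bounded_measurable_scaled_coord)
  have fin: "finite (U m \<sigma>)" if \<sigma>: "\<sigma> \<in> {-1, 1}" for m \<sigma>
  proof (rule ccontr)
    assume inf: "infinite (U m \<sigma>)"
    define D where "D = C * (\<bar>B\<bar> + 1) * Suc m"
    obtain r where r: "emeasure M A = ennreal r" "0 < r"
      using A by (cases "emeasure M A") (auto simp: is_atom_def)
    \<comment> \<open>The fixed measure \<open>r\<close> of \<open>A\<close> is compared with the
      tail of \<open>T ?S\<close> at level n / Suc m, which almost all of \<open>A\<close> exceeds.
      The right side tends to 0 because \<open>\<theta>\<close> is below 1.\<close>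
    have "r powr (1 / p) \<le> D * real n powr (\<theta> - 1)" if n: "1 \<le> n" for n
    proof -
      obtain K where K: "K \<subseteq> U m \<sigma>" "finite K" "card K = n"
        using infinite_arbitrarily_large[OF inf] by blast
      have KI: "K \<subseteq> I" using K(1) by (auto simp: U_def)
      let ?S = "\<lambda>x. \<Sum>i\<in>K. ?h i x"
      have S: "?S \<in> bounded_measurable (cantor_cube I)"
        using KI h by (intro bounded_measurable_sum) auto
      have "AE y in M. T ?S y = (\<Sum>i\<in>K. T (?h i) y)"
        using K(2) KI h by (intro T_sum) auto
      moreover have "AE y in M. \<forall>i\<in>K. y \<in> A \<longrightarrow> 1 / Suc m < \<sigma> * T (?h i) y"
        using K(1,2) by (intro AE_finite_allI) (auto simp: U_def)
      ultimately have "AE y in M. y \<in> A \<longrightarrow> y \<in> {y \<in> space M. n / Suc m < \<bar>T ?S y\<bar>}"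
        using AE_space
      proof eventually_elim
        case (elim y)
        show ?case
        proof
          assume y: "y \<in> A"
          have "(\<Sum>i\<in>K. 1 / Suc m) < (\<Sum>i\<in>K. \<sigma> * T (?h i) y)"
            using K(2,3) n elim(2) y by (intro sum_strict_mono) auto
          then have "n / Suc m < \<sigma> * T ?S y"
            using K(3) elim(1) by (simp add: sum_distrib_left)
          also have "\<sigma> * T ?S y \<le> \<bar>T ?S y\<bar>" using \<sigma> by auto
          finally show "y \<in> {y \<in> space M. n / Suc m < \<bar>T ?S y\<bar>}" using elim(3) by simp
        qed
      qed
      then have "emeasure M A \<le> emeasure M {y \<in> space M. n / Suc m < \<bar>T ?S y\<bar>}"
        using T_measurable[OF S] by (intro emeasure_mono_AE) measurable
      also have "\<dots> \<le> ennreal ((C * ((\<bar>B\<bar> + 1) * real (card K) powr \<theta>) / (n / Suc m)) powr p)"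
        using n norm[OF KI K(2)] by (intro emeasure_T_le[OF S]) auto
      also have "C * ((\<bar>B\<bar> + 1) * real (card K) powr \<theta>) / (n / Suc m) = D * real n powr (\<theta> - 1)"
        using n K(3) by (simp add: D_def powr_diff)
      finally have "r \<le> (D * real n powr (\<theta> - 1)) powr p"
        using r by simp
      then have "r powr (1 / p) \<le> ((D * real n powr (\<theta> - 1)) powr p) powr (1 / p)"
        using r p by (intro powr_mono2) auto
      also have "\<dots> = D * real n powr (\<theta> - 1)"
        using p C by (simp add: powr_powr D_def)
      finally show ?thesis .
    qed
    then have "\<forall>n\<ge>1. r powr (1 / p) \<le> D * real n powr (\<theta> - 1)" by blast
    moreover have "(\<lambda>n. D * real n powr (\<theta> - 1)) \<longlonglongrightarrow> D * 0"
      using \<theta> by (intro tendsto_mult_left tendsto_neg_powr filterlim_real_sequentially) auto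
    ultimately have "r powr (1 / p) \<le> D * 0"
      by (intro LIMSEQ_le_const) auto
    then show False using r by simp
  qed
  have "{i \<in> I. \<not> (AE y in M. y \<in> A \<longrightarrow> T (?h i) y = 0)} \<subseteq> (\<Union>m. \<Union>\<sigma>\<in>{-1, 1}. U m \<sigma>)"
    using atom_nonzero_function[OF A(1) T_measurable[OF h]] unfolding U_def by blast
  moreover have "countable (\<Union>m. \<Union>\<sigma>\<in>{-1, 1}. U m \<sigma>)"
    using fin by (intro countable_UN) (auto intro: countable_finite)
  ultimately show ?thesis by (rule countable_subset)
qed

text \<open>Since \<open>T f\<close> has finite weak norm, each set where its modulus exceeds 1 /
  Suc m has finite measure; hence the set where \<open>T f\<close> is nonzero is covered, up to a
  null set, by countably many atoms of finite measure. Each of these atoms excludes only countably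
  many indices.\<close>

lemma countable_overlap:
  assumes M: "purely_atomic M" and f: "f \<in> bounded_measurable (cantor_cube I)"
    and g: "g \<in> bounded_measurable (cantor_cube I)"
  shows "countable {i \<in> I. \<not> (AE y in M. T f y = 0 \<or> T (\<lambda>x. g x * x i) y = 0)}"
proof -
  define B where "B = (\<lambda>m::nat. {y \<in> space M. 1 / Suc m < \<bar>T f y\<bar>})"
  have "\<exists>\<A>. countable \<A> \<and> (\<forall>A\<in>\<A>. is_atom M A \<and> emeasure M A < \<infinity>) \<and> B m - \<Union>\<A> \<in> null_sets M" for m
  proof (rule purely_atomic_cover[OF M])
    show "B m \<in> sets M" unfolding B_def using T_measurable[OF f] by measurable
    obtain K where K: "0 \<le> K" "weak_norm M p (T f) = ennreal K"
      using finite_norm[OF f] by (cases "weak_norm M p (T f)") auto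
    then have "emeasure M (B m) \<le> ennreal ((K / (1 / Suc m)) powr p)"
      unfolding B_def using p by (intro weak_norm_leD) auto
    then show "emeasure M (B m) < \<infinity>" by (auto intro: le_less_trans)
  qed
  then obtain \<A> where \<A>: "\<And>m. countable (\<A> m)"
    "\<And>m A. A \<in> \<A> m \<Longrightarrow> is_atom M A \<and> emeasure M A < \<infinity>" "\<And>m. B m - \<Union>(\<A> m) \<in> null_sets M"
    by metis
  let ?N = "\<lambda>A. {i \<in> I. \<not> (AE y in M. y \<in> A \<longrightarrow> T (\<lambda>x. g x * x i) y = 0)}"
  have "AE y in M. T f y = 0 \<or> T (\<lambda>x. g x * x i) y = 0"
    if i: "i \<in> I" "i \<notin> (\<Union>m. \<Union>A\<in>\<A> m. ?N A)" for i
  proof -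
    have "AE y in M. \<forall>m. \<forall>A\<in>\<A> m. y \<in> A \<longrightarrow> T (\<lambda>x. g x * x i) y = 0"
      using i \<A>(1) by (subst AE_all_countable, intro allI AE_ball_countable') auto
    moreover have "AE y in M. \<forall>m. y \<notin> B m - \<Union>(\<A> m)"
      using AE_not_in[OF \<A>(3)] by (subst AE_all_countable) blast
    ultimately show ?thesis
      using AE_space
    proof eventually_elim
      case (elim y)
      show ?case
      proof (cases "T f y = 0")
        case False
        then obtain m where "1 / Suc m < \<bar>T f y\<bar>"
          using nat_approx_posE[of "\<bar>T f y\<bar>"] by (metis zero_less_abs_iff)
        then have "y \<in> B m" using elim(3) by (simp add: B_def)
        then show ?thesis using elim(1,2) by blast
      qed simp
    qed
  qed
  then have "{i \<in> I. \<not> (AE y in M. T f y = 0 \<or> T (\<lambda>x. g x * x i) y = 0)}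
      \<subseteq> (\<Union>m. \<Union>A\<in>\<A> m. ?N A)" by blast
  moreover have "countable (\<Union>m. \<Union>A\<in>\<A> m. ?N A)"
    using \<A>(1,2) countable_nonzero_on_atom[OF _ _ g] by (intro countable_UN) auto
  ultimately show ?thesis by (rule countable_subset)
qed

text \<open>Greedy choice: the earlier indices, together with those whose image overlaps an earlier
  image, form a countable set, which cannot exhaust \<open>J\<close>. Choosing from a subset
  \<open>J\<close> lets the indices be restricted beforehand, to coordinates with a common level or
  to coordinates that the multipliers do not involve.\<close>

lemma ex_disjoint_images:
  assumes M: "purely_atomic M" and J: "uncountable J" "J \<subseteq> I"
    and g: "\<And>k::nat. g k \<in> bounded_measurable (cantor_cube I)"
  shows "\<exists>s. inj_on s {..<n} \<and> s ` {..<n} \<subseteq> J \<and>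
    (\<forall>k<n. \<forall>l<n. k \<noteq> l \<longrightarrow> (AE y in M. T (\<lambda>x. g k x * x (s k)) y = 0 \<or> T (\<lambda>x. g l x * x (s l)) y = 0))"
proof (induction n)
  case 0
  show ?case by simp
next
  case (Suc n)
  then obtain s where s: "inj_on s {..<n}" "s ` {..<n} \<subseteq> J"
    "\<And>k l. k < n \<Longrightarrow> l < n \<Longrightarrow> k \<noteq> l \<Longrightarrow>
      AE y in M. T (\<lambda>x. g k x * x (s k)) y = 0 \<or> T (\<lambda>x. g l x * x (s l)) y = 0"
    by blast
  let ?N = "\<lambda>k. {i \<in> I. \<not> (AE y in M. T (\<lambda>x. g k x * x (s k)) y = 0 \<or> T (\<lambda>x. g n x * x i) y = 0)}"
  have "countable (?N k)" if "k < n" for k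
    using that s(2) J(2) g by (intro countable_overlap[OF M] bounded_measurable_scaled_coord) auto
  then have "countable (s ` {..<n} \<union> (\<Union>k<n. ?N k))" by auto
  then obtain j where j: "j \<in> J" "j \<notin> s ` {..<n} \<union> (\<Union>k<n. ?N k)"
    using J(1) by (meson countable_subset subsetI)
  have new: "AE y in M. T (\<lambda>x. g k x * x (s k)) y = 0 \<or> T (\<lambda>x. g n x * x j) y = 0" if "k < n" for k
    using j that J(2) by blast
  have new': "AE y in M. T (\<lambda>x. g n x * x j) y = 0 \<or> T (\<lambda>x. g k x * x (s k)) y = 0" if "k < n" for k
    using new[OF that] by (rule AE_mp) auto
  have "inj_on (s(n := j)) {..<Suc n}"
    using s(1) j(2) by (auto simp: lessThan_Suc inj_on_def)
  moreover have "(s(n := j)) ` {..<Suc n} \<subseteq> J"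
    using s(2) j(1) by (auto simp: lessThan_Suc)
  moreover have "AE y in M. T (\<lambda>x. g k x * x ((s(n := j)) k)) y = 0 \<or> T (\<lambda>x. g l x * x ((s(n := j)) l)) y = 0"
    if "k < Suc n" "l < Suc n" "k \<noteq> l" for k l
    using that s(3)[of k l] new[of k] new'[of l] by (cases "k = n"; cases "l = n") (simp_all del: fun_upd_apply add: fun_upd_same fun_upd_other)
  ultimately show ?case by blast
qed

section \<open>The case p < 2\<close>

text \<open>Disjoint functions which all have a fixed share of the level t span sums of norm at least of
  order n powr (1 / p), whereas the sum of n coordinates has norm at most sqrt n.\<close>

lemma not_less_2:
  assumes M: "purely_atomic M" and I: "uncountable I"
  shows "2 \<le> p"
proof (rule ccontr)
  assume "\<not> 2 \<le> p"
  then have p2: "p < 2" by simp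
  interpret prob_space "cantor_cube I" by (rule prob_space_cantor_cube)
  \<comment> \<open>If every tail of the image of a coordinate were below (\<delta> / t) powr p,
    that coordinate would have weak norm at most \<delta> / c = 1/4. But its modulus is 1, so at
    level 1/2 its tail is 1, which exceeds (1/2) powr p.\<close>
  define \<delta> where "\<delta> = c / 4"
  have \<delta>: "0 < \<delta>" using c by (simp add: \<delta>_def)
  have coord: "(\<lambda>x. x i) \<in> bounded_measurable (cantor_cube I)" if "i \<in> I" for i
    using that by (rule bounded_measurable_coord)
  \<comment> \<open>Levels are taken rational so that countably many classes cover \<open>I\<close>
    and one of them is uncountable. The factor 2 pays for replacing a level t by a rational between
    t / 2 and t.\<close>
  define U where "U = (\<lambda>q::rat. {i \<in> I. 0 < real_of_rat q \<and>
    ennreal ((\<delta> / (2 * real_of_rat q)) powr p) \<le> emeasure M {y \<in> space M. real_of_rat q < \<bar>T (\<lambda>x. x i) y\<bar>}})"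
  have "i \<in> (\<Union>q. U q)" if i: "i \<in> I" for i
  proof -
    have "\<exists>t>0. \<not> emeasure M {y \<in> space M. t < \<bar>T (\<lambda>x. x i) y\<bar>} \<le> ennreal ((\<delta> / t) powr p)"
    proof (rule ccontr)
      assume "\<not> ?thesis"
      then have "weak_norm (cantor_cube I) p (\<lambda>x. x i) \<le> ennreal (\<delta> / c)"
        using \<delta> by (intro weak_norm_le_T coord i) auto
      then have "emeasure (cantor_cube I) {x \<in> space (cantor_cube I). 1 / 2 < \<bar>x i\<bar>}
          \<le> ennreal ((\<delta> / c / (1 / 2)) powr p)"
        using p \<delta> c by (intro weak_norm_leD) auto
      moreover have "{x \<in> space (cantor_cube I). 1 / 2 < \<bar>x i\<bar>} = space (cantor_cube I)"
        using cantor_cube_coord[OF _ i] by force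
      ultimately have "1 \<le> ennreal ((1 / 2) powr p)"
        using c by (simp add: \<delta>_def emeasure_space_1)
      then have "1 \<le> (1 / 2 :: real) powr p" by simp
      moreover have "(1 / 2 :: real) powr p < (1 / 2) powr 0"
        using p by (intro powr_less_mono') auto
      ultimately show False by simp
    qed
    then obtain t where t: "0 < t"
      "ennreal ((\<delta> / t) powr p) \<le> emeasure M {y \<in> space M. t < \<bar>T (\<lambda>x. x i) y\<bar>}"
      by (auto simp: not_le intro: less_imp_le)
    obtain q where q: "t / 2 < real_of_rat q" "real_of_rat q < t"
      using of_rat_dense[of "t / 2" t] t(1) by auto
    have q0: "0 < real_of_rat q" using q(1) t(1) by linarith
    have "(\<delta> / (2 * real_of_rat q)) powr p \<le> (\<delta> / t) powr p"
      using q q0 t(1) \<delta> p by (intro powr_mono2 divide_left_mono) auto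
    then have "ennreal ((\<delta> / (2 * real_of_rat q)) powr p) \<le> ennreal ((\<delta> / t) powr p)"
      by (rule ennreal_leI)
    also note t(2)
    also have "emeasure M {y \<in> space M. t < \<bar>T (\<lambda>x. x i) y\<bar>}
        \<le> emeasure M {y \<in> space M. real_of_rat q < \<bar>T (\<lambda>x. x i) y\<bar>}"
    proof (rule emeasure_mono)
      show "{y \<in> space M. real_of_rat q < \<bar>T (\<lambda>x. x i) y\<bar>} \<in> sets M"
        using T_measurable[OF coord[OF i]] by measurable
    qed (use q in auto)
    finally show ?thesis using i q0 unfolding U_def by auto
  qed
  then have "I \<subseteq> (\<Union>q. U q)" by blast
  then have "uncountable (\<Union>q. U q)" using I countable_subset by blast
  then obtain q where q: "uncountable (U q)" by auto
  then have "U q \<noteq> {}" by auto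
  define t where "t = real_of_rat q"
  define d where "d = (\<delta> / (2 * t)) powr p"
  have t: "0 < t" using \<open>U q \<noteq> {}\<close> by (auto simp: U_def t_def)
  have d: "0 < d" using t \<delta> by (simp add: d_def)
  have le: "ennreal d \<le> emeasure M {y \<in> space M. t < \<bar>T (\<lambda>x. x i) y\<bar>}" if "i \<in> U q" for i
    using that by (simp add: U_def d_def t_def)
  \<comment> \<open>Each of n disjoint images has mass at least \<open>d\<close> above level
    \<open>t\<close>, so n * d is at most (C * sqrt n / t) powr p. For p < 2 the right side grows
    more slowly than n.\<close>
  have "1 \<le> (C / t) powr p / d * real n powr (p / 2 - 1)" if n: "1 \<le> n" for n
  proof -
    have "U q \<subseteq> I" by (auto simp: U_def)
    from ex_disjoint_images[OF M q this, of "\<lambda>_ _. 1" n]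
    obtain s where s: "inj_on s {..<n}" "s ` {..<n} \<subseteq> U q"
      "\<And>k l. k < n \<Longrightarrow> l < n \<Longrightarrow> k \<noteq> l \<Longrightarrow>
        AE y in M. T (\<lambda>x. x (s k)) y = 0 \<or> T (\<lambda>x. x (s l)) y = 0"
      by (auto simp: bounded_measurable_const)
    have sI: "s k \<in> I" if "k < n" for k using s(2) that by (auto simp: U_def)
    have S: "(\<lambda>x. \<Sum>k<n. x (s k)) \<in> bounded_measurable (cantor_cube I)"
      using sI by (intro bounded_measurable_sum coord) auto
    have reindex: "(\<Sum>i\<in>s ` {..<n}. x i) = (\<Sum>k<n. x (s k))" for x :: "'i \<Rightarrow> real"
      using s(1) by (simp add: sum.reindex)
    have "weak_norm (cantor_cube I) p (\<lambda>x. \<Sum>k<n. x (s k)) \<le> ennreal (sqrt n)"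
      using weak_norm_rademacher_sum_le2[of "s ` {..<n}" I p] sI p p2 s(1)
      by (auto simp: reindex card_image)
    then have up: "emeasure M {y \<in> space M. t < \<bar>T (\<lambda>x. \<Sum>k<n. x (s k)) y\<bar>} \<le> ennreal ((C * sqrt n / t) powr p)"
      using t by (intro emeasure_T_le S) auto
    have "ennreal (n * d) = (\<Sum>k<n. ennreal d)"
      using d by (simp add: ennreal_mult ennreal_of_nat_eq_real_of_nat)
    also have "\<dots> \<le> (\<Sum>k<n. emeasure M {y \<in> space M. t < \<bar>T (\<lambda>x. x (s k)) y\<bar>})"
      using le s(2) by (intro sum_mono) auto
    also have "\<dots> = emeasure M {y \<in> space M. t < \<bar>T (\<lambda>x. \<Sum>k<n. x (s k)) y\<bar>}"
      using s(3) t sI coord by (intro emeasure_T_disjoint_sum[symmetric]) auto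
    also note up
    finally have "n * d \<le> (C * sqrt n / t) powr p" by simp
    also have "C * sqrt n / t = (C / t) * real n powr (1 / 2)" by (simp add: powr_half_sqrt)
    also have "\<dots> powr p = (C / t) powr p * real n powr (p / 2)"
      by (subst powr_mult) (simp add: powr_powr)
    finally have "n * d \<le> (C / t) powr p * real n powr (p / 2)" .
    moreover have "real n powr (p / 2) = real n powr (p / 2 - 1) * n"
      using n by (simp add: powr_diff del: powr_mult_base)
    ultimately show ?thesis
      using n d by (simp add: field_simps del: diff_divide_distrib)
  qed
  then have "\<forall>n\<ge>1. 1 \<le> (C / t) powr p / d * real n powr (p / 2 - 1)" by blast
  moreover have "(\<lambda>n. (C / t) powr p / d * real n powr (p / 2 - 1)) \<longlonglongrightarrow> (C / t) powr p / d * 0"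
    using p2 by (intro tendsto_mult_left tendsto_neg_powr filterlim_real_sequentially) auto
  ultimately have "1 \<le> (C / t) powr p / d * 0"
    by (intro LIMSEQ_le_const) auto
  then show False by simp
qed

end

section \<open>The case p \<ge> 2\<close>

lemma two_point_singleton: "e \<in> {-1, 1} \<Longrightarrow> emeasure two_point {e} = ennreal (1 / 2)"
  by (subst emeasure_two_point) auto

text \<open>\<open>v\<close> numbers the sign patterns on \<open>J\<close>, so its level sets are
  the cylinders that fix all coordinates in \<open>J\<close>. This yields equally likely cells that
  ignore every coordinate outside \<open>J\<close>; their number is a power of 2, which is why
  \<open>N\<close> is one below.\<close>

lemma cantor_cube_cells:
  fixes I :: "'i set"
  assumes "finite J" "J \<subseteq> I"
  shows "\<exists>v :: ('i \<Rightarrow> real) \<Rightarrow> nat. (\<forall>x\<in>space (cantor_cube I). v x < 2 ^ card J)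
    \<and> (\<forall>q<2 ^ card J. {x \<in> space (cantor_cube I). v x = q} \<in> sets (cantor_cube I) \<and>
        measure (cantor_cube I) {x \<in> space (cantor_cube I). v x = q} = 1 / 2 ^ card J)
    \<and> (\<forall>x i r. i \<notin> J \<longrightarrow> v (x(i := r)) = v x)"
proof -
  interpret P: product_prob_space "\<lambda>_. two_point" I by (rule product_prob_space_two_point)
  let ?Z = "\<Pi>\<^sub>E i\<in>J. {-1, 1 :: real}"
  have "card ?Z = 2 ^ card J" using assms(1) by (simp add: card_PiE numeral_2_eq_2)
  moreover have "finite ?Z" using assms(1) by (intro finite_PiE) auto
  ultimately obtain b where b: "bij_betw b ?Z {0..<2 ^ card J :: nat}"
    using ex_bij_betw_finite_nat[of ?Z] by auto
  define v where "v = (\<lambda>x. b (restrict x J))"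
  have res: "restrict x J \<in> ?Z" if "x \<in> space (cantor_cube I)" for x
    using that assms(2) by (auto simp: space_cantor_cube PiE_iff)
  have "v x < 2 ^ card J" if "x \<in> space (cantor_cube I)" for x
    using bij_betw_apply[OF b res[OF that]] by (simp add: v_def)
  moreover have "{x \<in> space (cantor_cube I). v x = q} \<in> sets (cantor_cube I) \<and>
      measure (cantor_cube I) {x \<in> space (cantor_cube I). v x = q} = 1 / 2 ^ card J"
    if q: "q < 2 ^ card J" for q
  proof -
    obtain z where z: "z \<in> ?Z" "b z = q"
    proof -
      have "q \<in> b ` ?Z" unfolding bij_betw_imp_surj_on[OF b] using q by simp
      then show ?thesis using that by blast
    qed
    have eq: "{x \<in> space (cantor_cube I). v x = q} = {x \<in> space (cantor_cube I). \<forall>i\<in>J. x i \<in> {z i}}"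
    proof (rule Collect_cong, rule conj_cong[OF refl])
      fix x assume x: "x \<in> space (cantor_cube I)"
      have "v x = q \<longleftrightarrow> restrict x J = z"
        using inj_on_eq_iff[OF bij_betw_imp_inj_on[OF b] res[OF x] z(1)] z(2) by (simp add: v_def)
      also have "\<dots> \<longleftrightarrow> (\<forall>i\<in>J. x i \<in> {z i})"
        using z(1) by (auto simp: PiE_iff extensional_def fun_eq_iff restrict_def)
      finally show "v x = q \<longleftrightarrow> (\<forall>i\<in>J. x i \<in> {z i})" .
    qed
    have zi: "z i \<in> {-1, 1}" if "i \<in> J" for i using z(1) that by (auto simp: PiE_iff)
    have "emeasure (cantor_cube I) {x \<in> space (cantor_cube I). \<forall>i\<in>J. x i \<in> {z i}}
        = (\<Prod>i\<in>J. emeasure two_point {z i})"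
      unfolding cantor_cube_def using assms zi by (intro P.emeasure_PiM_Collect) auto
    also have "\<dots> = (\<Prod>i\<in>J. ennreal (1 / 2))"
      using zi by (intro prod.cong refl two_point_singleton) auto
    also have "\<dots> = ennreal (1 / 2 ^ card J)"
      by (simp add: ennreal_power power_divide del: ennreal_half)
    finally have "measure (cantor_cube I) {x \<in> space (cantor_cube I). v x = q} = 1 / 2 ^ card J"
      unfolding eq by (simp add: measure_def)
    moreover have "{x \<in> space (cantor_cube I). \<forall>i\<in>J. x i \<in> {z i}} \<in> sets (cantor_cube I)"
    proof (rule sets.sets_Collect_finite_All[OF _ assms(1)])
      fix i assume "i \<in> J"
      then have "(\<lambda>x. x i) -` {z i} \<inter> space (cantor_cube I) \<in> sets (cantor_cube I)"
        using assms(2) zi by (intro measurable_sets[OF measurable_coord_two_point]) auto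
      also have "(\<lambda>x. x i) -` {z i} \<inter> space (cantor_cube I) = {x \<in> space (cantor_cube I). x i \<in> {z i}}"
        by blast
      finally show "{x \<in> space (cantor_cube I). x i \<in> {z i}} \<in> sets (cantor_cube I)" .
    qed
    ultimately show ?thesis unfolding eq by simp
  qed
  moreover have "v (x(i := r)) = v x" if "i \<notin> J" for x i r
    using that by (auto simp: v_def intro!: arg_cong[of _ _ b] restrict_ext)
  ultimately show ?thesis by (intro exI[of _ v]) blast
qed

lemma bij_betw_add_mod:
  fixes N k :: nat
  assumes N: "0 < N"
  shows "bij_betw (\<lambda>q. (q + k) mod N) {..<N} {..<N}"
proof -
  have le: "a = b" if "a \<le> b" "b < N" "(a + k) mod N = (b + k) mod N" for a b
  proof -
    have "N dvd (b + k) - (a + k)"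
      using that by (subst mod_eq_dvd_iff_nat[symmetric]) auto
    then have "N dvd b - a" by simp
    then show ?thesis using that by (auto dest: dvd_imp_le)
  qed
  have "inj_on (\<lambda>q. (q + k) mod N) {..<N}"
  proof (rule inj_onI)
    fix a b assume "a \<in> {..<N}" "b \<in> {..<N}" "(a + k) mod N = (b + k) mod N"
    then show "a = b" using le[of a b] le[of b a] by (cases "a \<le> b") auto
  qed
  moreover have "(\<lambda>q. (q + k) mod N) ` {..<N} \<subseteq> {..<N}" using N by auto
  ultimately show ?thesis by (simp add: bij_betw_def endo_inj_surj)
qed

lemma sum_shift_mod:
  fixes N k :: nat and f :: "nat \<Rightarrow> real"
  assumes "0 < N"
  shows "(\<Sum>q<N. f ((q + k) mod N)) = (\<Sum>q<N. f q)"
  by (rule sum.reindex_bij_betw[OF bij_betw_add_mod[OF assms]])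

text \<open>The N functions g k are the cyclic shifts of (N / (j + 1)) powr (1 / p), j < N, placed on N cells
  of equal measure; the sum over all shifts does not depend on the cell.\<close>

lemma shifted_profiles:
  fixes I :: "'i set" and m N :: nat and p :: real
  assumes I: "infinite I" and p: "2 \<le> p" and N_def: "N = 2 ^ m"
  obtains J and g :: "nat \<Rightarrow> ('i \<Rightarrow> real) \<Rightarrow> real" and L where
    "finite J" "J \<subseteq> I" "N powr (2 / p) * harm N \<le> L"
    "\<And>k. g k \<in> bounded_measurable (cantor_cube I)"
    "\<And>k. weak_norm (cantor_cube I) p (g k) \<le> ennreal 1"
    "\<And>k x i r. i \<notin> J \<Longrightarrow> g k (x(i := r)) = g k x"
    "\<And>x. (\<Sum>k<N. (g k x)\<^sup>2) = L"
proof -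
  let ?C = "cantor_cube I"
  interpret prob_space ?C by (rule prob_space_cantor_cube)
  have N: "0 < N" by (simp add: N_def)
  obtain J where J: "J \<subseteq> I" "finite J" "card J = m"
    using infinite_arbitrarily_large[OF I] by blast
  obtain v :: "('i \<Rightarrow> real) \<Rightarrow> nat" where v': "\<forall>x\<in>space ?C. v x < 2 ^ m"
    "\<forall>q<2 ^ m. {x \<in> space ?C. v x = q} \<in> sets ?C \<and> measure ?C {x \<in> space ?C. v x = q} = 1 / 2 ^ m"
    "\<forall>x i r. i \<notin> J \<longrightarrow> v (x(i := r)) = v x"
    using cantor_cube_cells[OF J(2,1)] unfolding J(3) by blast
  have v: "v x < N" if "x \<in> space ?C" for x
    using v'(1) that by (simp add: N_def)
  have cell: "{x \<in> space ?C. v x = q} \<in> sets ?C" "measure ?C {x \<in> space ?C. v x = q} = 1 / N"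
    if "q < N" for q
    using v'(2) that by (simp_all add: N_def)
  \<comment> \<open>The step version of u powr (- 1 / p), the model function of weak norm 1:
    \<open>\<phi> j\<close> exceeds \<open>t\<close> exactly when j + 1 < N / t powr p, so the
    proportion of such steps is at most (1 / t) powr p.\<close>
  define \<phi> where "\<phi> = (\<lambda>j::nat. (N / (j + 1)) powr (1 / p))"
  define g where "g = (\<lambda>k x. \<phi> ((v x + k) mod N))"
  define L where "L = (\<Sum>j<N. (\<phi> j)\<^sup>2)"
  \<comment> \<open>For p \<ge> 2 the power (j + 1) powr (2 / p) is at most j + 1, so every such
    \<open>p\<close> is bounded below by the harmonic terms that occur for p = 2.\<close>
  have "(\<phi> j)\<^sup>2 \<ge> N powr (2 / p) * inverse (real (Suc j))" for j
  proof -
    have "(\<phi> j)\<^sup>2 = (N / (j + 1)) powr (2 / p)"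
      by (simp add: \<phi>_def power2_eq_square powr_add[symmetric])
    also have "\<dots> = N powr (2 / p) * inverse (real (Suc j) powr (2 / p))"
      by (subst powr_divide) (simp_all add: divide_inverse add.commute)
    finally have "(\<phi> j)\<^sup>2 = N powr (2 / p) * inverse (real (Suc j) powr (2 / p))" .
    moreover have "real (Suc j) powr (2 / p) \<le> real (Suc j) powr 1"
      using p by (intro powr_mono) auto
    ultimately show ?thesis
      by (auto intro!: mult_left_mono le_imp_inverse_le)
  qed
  then have "(\<Sum>j<N. N powr (2 / p) * inverse (real (Suc j))) \<le> L"
    unfolding L_def by (intro sum_mono) auto
  moreover have "harm N = (\<Sum>j<N. inverse (real (Suc j)))"
    unfolding harm_def by (rule sum.reindex_bij_witness[of _ Suc "\<lambda>k. k - 1"]) auto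
  ultimately have L: "N powr (2 / p) * harm N \<le> L" by (simp add: sum_distrib_left)
  have sq: "(\<Sum>k<N. (g k x)\<^sup>2) = L" for x
    using sum_shift_mod[OF N, of "\<lambda>j. (\<phi> j)\<^sup>2" "v x"] by (simp add: g_def L_def add.commute)
  have g_bm: "g k \<in> bounded_measurable ?C" for k
  proof (rule bounded_measurableI)
    have "(\<lambda>x. \<Sum>q<N. \<phi> ((q + k) mod N) * indicator {x \<in> space ?C. v x = q} x) \<in> borel_measurable ?C"
      using cell(1) by (intro borel_measurable_sum borel_measurable_times borel_measurable_indicator) auto
    moreover have "(\<Sum>q<N. \<phi> ((q + k) mod N) * indicator {x \<in> space ?C. v x = q} x) = g k x"
      if x: "x \<in> space ?C" for x
    proof -
      have "(\<Sum>q<N. \<phi> ((q + k) mod N) * indicator {x \<in> space ?C. v x = q} x)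
          = (\<Sum>q<N. if q = v x then g k x else 0)"
        using x by (intro sum.cong) (auto simp: g_def indicator_def)
      then show ?thesis using v[OF x] by simp
    qed
    ultimately show "g k \<in> borel_measurable ?C"
      using measurable_cong[of ?C "\<lambda>x. \<Sum>q<N. \<phi> ((q + k) mod N) * indicator {x \<in> space ?C. v x = q} x" "g k" borel]
      by blast
    show "\<bar>g k x\<bar> \<le> (\<Sum>j<N. \<bar>\<phi> j\<bar>)" for x
      unfolding g_def using N by (intro member_le_sum[of _ _ "\<lambda>j. \<bar>\<phi> j\<bar>"]) auto
  qed
  have "weak_norm ?C p (g k) \<le> ennreal 1" for k
  proof (subst weak_norm_le_iff)
    show "\<forall>t>0. emeasure ?C {x \<in> space ?C. t < \<bar>g k x\<bar>} \<le> ennreal ((1 / t) powr p)"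
    proof (intro allI impI)
      fix t :: real assume t: "t > 0"
      let ?Q = "{j \<in> {..<N}. t < \<phi> j}" and ?Q' = "{q \<in> {..<N}. t < \<phi> ((q + k) mod N)}"
      have "real (j + 1) < N / t powr p" if "t < \<phi> j" for j
      proof -
        have "t powr p < (\<phi> j) powr p" using that t p by (intro powr_less_mono2) auto
        also have "\<dots> = N / (j + 1)" using p by (simp add: \<phi>_def powr_powr)
        finally show ?thesis using t by (simp add: field_simps)
      qed
      then have "j + 1 \<le> nat \<lfloor>N / t powr p\<rfloor>" if "t < \<phi> j" for j
        using that by (intro le_nat_floor less_imp_le)
      then have "?Q \<subseteq> {..<nat \<lfloor>N / t powr p\<rfloor>}" by fastforce
      then have "card ?Q \<le> nat \<lfloor>N / t powr p\<rfloor>"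
        using card_mono[of "{..<nat \<lfloor>N / t powr p\<rfloor>}" ?Q] by simp
      then have cardQ: "real (card ?Q) \<le> N / t powr p"
        using of_nat_floor[of "N / t powr p"] by (meson divide_nonneg_nonneg of_nat_0_le_iff of_nat_mono order_trans powr_ge_zero)
      have "bij_betw (\<lambda>q. (q + k) mod N) ?Q' ?Q"
        by (rule bij_betw_Collect[OF bij_betw_add_mod[OF N]]) simp
      then have cardQ': "card ?Q' = card ?Q" by (rule bij_betw_same_card)
      have "measure ?C {x \<in> space ?C. t < \<bar>g k x\<bar>} \<le> measure ?C (\<Union>q\<in>?Q'. {x \<in> space ?C. v x = q})"
        using cell(1) v by (intro finite_measure_mono) (auto simp: g_def \<phi>_def)
      also have "\<dots> \<le> (\<Sum>q\<in>?Q'. measure ?C {x \<in> space ?C. v x = q})"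
        using cell(1) by (intro finite_measure_subadditive_finite) auto
      also have "\<dots> = (\<Sum>q\<in>?Q'. 1 / N)"
        using cell(2) by (intro sum.cong) auto
      also have "\<dots> = card ?Q / N" using cardQ' by simp
      also have "\<dots> \<le> (N / t powr p) / N"
        using cardQ by (rule divide_right_mono) simp
      also have "\<dots> = (1 / t) powr p"
        using N t by (simp add: powr_divide)
      finally show "emeasure ?C {x \<in> space ?C. t < \<bar>g k x\<bar>} \<le> ennreal ((1 / t) powr p)"
        by (simp add: emeasure_eq_measure)
    qed
  qed (use p in auto)
  note norm = this
  have upd: "g k (x(i := r)) = g k x" if "i \<notin> J" for k x i r
    using v'(3) that by (simp add: g_def del: fun_upd_apply)
  show thesis
    by (rule that[of J L g]) (fact J L g_bm norm upd sq)+
qed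

context cube_embedding
begin

text \<open>Conditionally on the profiles g k, the sum of g k x * x (s k) over k < N has the constant
  variance L and hence size sqrt L, whereas disjointness of the images bounds its weak norm by a
  multiple of N powr (1 / p).\<close>

lemma harm_bounded:
  assumes M: "purely_atomic M" and I: "uncountable I" and p2: "2 \<le> p"
  shows "sqrt (harm (2 ^ m)) \<le> 2 * C / c * 6 powr (1 / p)"
proof -
  let ?C = "cantor_cube I"
  define N :: nat where "N = 2 ^ m"
  have N: "0 < N" by (simp add: N_def)
  have "infinite I" using I by (auto intro: countable_finite)
  then obtain J and g :: "nat \<Rightarrow> ('i \<Rightarrow> real) \<Rightarrow> real" and L where J: "finite J" "J \<subseteq> I"
    and L: "N powr (2 / p) * harm N \<le> L"
    and g: "\<And>k. g k \<in> bounded_measurable ?C" "\<And>k. weak_norm ?C p (g k) \<le> ennreal 1"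
    and g_upd: "\<And>k x i r. i \<notin> J \<Longrightarrow> g k (x(i := r)) = g k x"
    and sq: "\<And>x. (\<Sum>k<N. (g k x)\<^sup>2) = L"
    by (rule shifted_profiles[OF _ p2 N_def]) (rule that)
  \<comment> \<open>Indices outside \<open>J\<close> make every \<open>g k\<close> invariant under
    the flips at all \<open>s l\<close>, as both moment lemmas require.\<close>
  have "uncountable (I - J)"
    using I J by (simp add: uncountable_minus_countable countable_finite)
  from ex_disjoint_images[OF M this Diff_subset, of g N, OF g(1)] obtain s where
    s: "inj_on s {..<N}" "s ` {..<N} \<subseteq> I - J"
    and disj': "\<forall>k<N. \<forall>l<N. k \<noteq> l \<longrightarrow>
      (AE y in M. T (\<lambda>x. g k x * x (s k)) y = 0 \<or> T (\<lambda>x. g l x * x (s l)) y = 0)"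
    by (elim exE conjE)
  have disj: "AE y in M. T (\<lambda>x. g k x * x (s k)) y = 0 \<or> T (\<lambda>x. g l x * x (s l)) y = 0"
    if "k < N" "l < N" "k \<noteq> l" for k l
    using disj'[rule_format, OF that] .
  interpret prob_space ?C by (rule prob_space_cantor_cube)
  define S where "S = (\<lambda>x. \<Sum>k<N. g k x * x (s k))"
  have sI: "s k \<in> I" "s k \<notin> J" if "k < N" for k using s(2) that by auto
  have h: "(\<lambda>x. g k x * x (s k)) \<in> bounded_measurable ?C" if "k < N" for k
    using sI[OF that] g(1) by (intro bounded_measurable_scaled_coord)
  have S: "S \<in> bounded_measurable ?C"
    unfolding S_def using h by (intro bounded_measurable_sum) auto
  have harm: "0 < (harm N :: real)" using N by (rule harm_pos)
  have "0 < N powr (2 / p) * harm N" using harm N by simp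
  then have L0: "0 < L" using L by (rule less_le_trans)
  have "(\<integral>x. (S x)\<^sup>2 \<partial>?C) = (\<integral>x. (\<Sum>k<N. (g k x)\<^sup>2) * 1 \<partial>?C)"
    unfolding S_def
    using s(1) sI(1) g(1) g_upd[OF sI(2)] rademacher_second_moment[of "{..<N}" s I g "\<lambda>_. 1"]
    by (simp add: image_subset_iff bounded_measurable_const del: fun_upd_apply)
  also have "\<dots> = (\<integral>x. L \<partial>?C)" by (simp add: sq)
  finally have m2: "(\<integral>x. (S x)\<^sup>2 \<partial>?C) = L" by (simp add: prob_space)
  have "(\<integral>x. S x ^ 4 \<partial>?C) \<le> 3 * (\<integral>x. (\<Sum>k<N. (g k x)\<^sup>2)\<^sup>2 \<partial>?C)"
    unfolding S_def using s(1) sI(1) g(1) g_upd[OF sI(2)]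
    by (intro rademacher_fourth_moment) (simp_all add: image_subset_iff del: fun_upd_apply)
  also have "(\<integral>x. (\<Sum>k<N. (g k x)\<^sup>2)\<^sup>2 \<partial>?C) = (\<integral>x. L\<^sup>2 \<partial>?C)"
    by (simp add: sq)
  finally have m4: "(\<integral>x. S x ^ 4 \<partial>?C) \<le> 3 * L\<^sup>2" by (simp add: prob_space)
  have big: "1 / 6 \<le> measure ?C {x \<in> space ?C. sqrt L / 2 < \<bar>S x\<bar>}"
    by (rule paley_zygmund[OF prob_space_axioms S L0 m2 m4])
  \<comment> \<open>A coordinate has modulus 1, so multiplying by it keeps the norm bound of the
    profile.\<close>
  have hnorm: "weak_norm ?C p (\<lambda>x. g k x * x (s k)) \<le> ennreal 1" if "k < N" for k
  proof -
    have "\<bar>x (s k)\<bar> = 1" if "x \<in> space ?C" for x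
      using cantor_cube_coord[OF that sI(1)[OF \<open>k < N\<close>]] by auto
    then have "weak_norm ?C p (\<lambda>x. g k x * x (s k)) \<le> ennreal (1 * 1)"
      using p g(1)[THEN bounded_measurable_measurable] g(2)
      by (intro weak_norm_mono_scaled) (auto simp: abs_mult)
    then show ?thesis by simp
  qed
  have "emeasure M {y \<in> space M. t < \<bar>T S y\<bar>} \<le> ennreal ((C * N powr (1 / p) / t) powr p)"
    if t: "0 < t" for t
  proof -
    have "emeasure M {y \<in> space M. t < \<bar>T S y\<bar>}
        = (\<Sum>k<N. emeasure M {y \<in> space M. t < \<bar>T (\<lambda>x. g k x * x (s k)) y\<bar>})"
      unfolding S_def using h disj t by (intro emeasure_T_disjoint_sum) auto
    also have "\<dots> \<le> (\<Sum>k<N. ennreal ((C * 1 / t) powr p))"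
      using h hnorm t by (intro sum_mono emeasure_T_le) auto
    also have "\<dots> = ennreal (N * (C / t) powr p)"
      by (simp add: ennreal_mult ennreal_of_nat_eq_real_of_nat)
    also have "N * (C / t) powr p = (C * N powr (1 / p) / t) powr p"
      using C t p by (simp add: powr_divide powr_mult powr_powr)
    finally show ?thesis .
  qed
  then have norm: "weak_norm ?C p S \<le> ennreal (C * N powr (1 / p) / c)"
    using C by (intro weak_norm_le_T S) auto
  \<comment> \<open>The tail is evaluated at the level where its probability is known to be at least
    1/6; the level sqrt L / 2 and this probability are the sources of the factors 2 and 6 powr (1 /
    p).\<close>
  have "emeasure ?C {x \<in> space ?C. sqrt L / 2 < \<bar>S x\<bar>} \<le> ennreal ((C * N powr (1 / p) / c / (sqrt L / 2)) powr p)"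
    using p C c L0 by (intro weak_norm_leD[OF norm]) auto
  then have "1 / 6 \<le> (C * N powr (1 / p) / c / (sqrt L / 2)) powr p"
    using big by (simp add: emeasure_eq_measure)
  then have "(1 / 6) powr (1 / p) \<le> ((C * N powr (1 / p) / c / (sqrt L / 2)) powr p) powr (1 / p)"
    using p by (intro powr_mono2) auto
  also have "\<dots> = C * N powr (1 / p) / c / (sqrt L / 2)"
    using p C c L0 by (simp add: powr_powr)
  finally have "sqrt L \<le> 2 * C / c * 6 powr (1 / p) * N powr (1 / p)"
    using C c L0 by (simp add: powr_divide field_simps)
  moreover have "N powr (1 / p) * sqrt (harm N) \<le> sqrt L"
  proof -
    have "N powr (1 / p) * sqrt (harm N) = sqrt (N powr (2 / p) * harm N)"
      by (simp add: real_sqrt_mult powr_half_sqrt[symmetric] powr_powr)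
    then show ?thesis using L by simp
  qed
  ultimately have "N powr (1 / p) * sqrt (harm N) \<le> N powr (1 / p) * (2 * C / c * 6 powr (1 / p))"
    by (simp add: mult_ac)
  moreover have "0 < N powr (1 / p)" using N by simp
  ultimately show ?thesis unfolding N_def[symmetric] by (rule mult_left_le_imp_le)
qed

text \<open>The bound on \<open>harm (2 ^ m)\<close> is uniform in \<open>m\<close>, whereas the
  harmonic numbers dominate the logarithm, that is m * ln 2.\<close>

lemma not_purely_atomic:
  assumes I: "uncountable I"
  shows "\<not> purely_atomic M"
proof
  assume M: "purely_atomic M"
  let ?D = "2 * C / c * 6 powr (1 / p)"
  have le: "m * ln 2 \<le> ?D\<^sup>2" for m :: nat
  proof -
    have "m * ln 2 = ln (2 ^ m :: real)" by (simp add: ln_realpow)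
    also have "\<dots> \<le> ln (real (2 ^ m) + 1)" by (simp add: ln_mono)
    also have "\<dots> \<le> harm (2 ^ m)" by (rule ln_le_harm)
    also have "\<dots> = (sqrt (harm (2 ^ m)))\<^sup>2" by (simp add: harm_nonneg)
    also have "\<dots> \<le> ?D\<^sup>2"
      using harm_bounded[OF M I not_less_2[OF M I], of m] by (intro power_mono) (auto simp: harm_nonneg)
    finally show ?thesis .
  qed
  have "real m \<le> ?D\<^sup>2 / ln 2" for m
    using le[of m] by (subst pos_le_divide_eq) auto
  then show False using reals_Archimedean2 by (meson not_le)
qed

end

theorem theorem2:
  fixes p :: real and I :: "'i set" and M :: "'a measure"
  assumes "1 < p" and "uncountable I"
    and "\<exists>A \<in> sets M. 0 < emeasure M A \<and> emeasure M A < \<infinity>"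
    and "purely_atomic M"
  shows "\<not> weak_Lp_embeds (cantor_cube I) M p"
proof
  assume "weak_Lp_embeds (cantor_cube I) M p"
  then obtain T :: "(('i \<Rightarrow> real) \<Rightarrow> real) \<Rightarrow> 'a \<Rightarrow> real" and c C :: real where c: "0 < c"
    and bounds: "\<And>f. f \<in> Lp_weak (cantor_cube I) p \<Longrightarrow> T f \<in> Lp_weak M p \<and>
      ennreal c * weak_norm (cantor_cube I) p f \<le> weak_norm M p (T f) \<and>
      weak_norm M p (T f) \<le> ennreal C * weak_norm (cantor_cube I) p f"
    and lin: "\<And>f g a b. f \<in> Lp_weak (cantor_cube I) p \<Longrightarrow> g \<in> Lp_weak (cantor_cube I) p \<Longrightarrow>
      AE y in M. T (\<lambda>x. a * f x + b * g x) y = a * T f y + b * T g y"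
    unfolding weak_Lp_embeds_def by blast
  interpret prob_space "cantor_cube I" by (rule prob_space_cantor_cube)
  have sub: "f \<in> Lp_weak (cantor_cube I) p" if "f \<in> bounded_measurable (cantor_cube I)" for f
    using bounded_measurable_Lp_weak[OF that] assms(1) by simp
  \<comment> \<open>The upper constant of an embedding comes without a sign condition; enlarging it
    to at least 1 keeps the bound and makes it positive.\<close>
  interpret cube_embedding p c "max C 1" I M T
  proof
    fix f assume "f \<in> bounded_measurable (cantor_cube I)"
    note f = bounds[OF sub[OF this]]
    then have "weak_norm M p (T f) \<le> ennreal C * weak_norm (cantor_cube I) p f" by blast
    also have "\<dots> \<le> ennreal (max C 1) * weak_norm (cantor_cube I) p f"
      by (intro mult_right_mono ennreal_leI) auto
    finally show "weak_norm M p (T f) \<le> ennreal (max C 1) * weak_norm (cantor_cube I) p f" .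
    show "T f \<in> borel_measurable M" "weak_norm M p (T f) < \<infinity>"
      "ennreal c * weak_norm (cantor_cube I) p f \<le> weak_norm M p (T f)"
      using f by (auto simp: Lp_weak_def)
  qed (use assms(1) c lin sub in auto)
  show False using not_purely_atomic assms(2,4) by blast
qed

end
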